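(* There is an absolute constant $c>0$ such that, for all sufficiently large integers $n$, \[ c\sqrt{\log n}\;\leq\; S(n)\;\leq\; \pi n . \] Consequently, $S(n)\to\infty$ as $n\to\infty$.
   Context: Let $\overline{\mathbb D}=\{z\in\mathbb C:|z|\le 1\}$ and $\partial\mathbb D=\{z\in\mathbb C:|z|=1\}$. For $n\ge 1$ let $\mathcal P_n$ be the class of monic polynomials $f(z)=\prod_{j=1}^n(z-a_j)$ of degree $n$ all of whose zeros satisfy $|a_j|\le 1$. For $f\in\mathcal P_n$ put $E_f=\{z\in\mathbb C:|z|\le 1,\ |f(z)|\le 1\}$ (note $0\in E_f$). Define \[ S(n)=\sup_{f\in\mathcal P_n}\ \inf\{\ell(\gamma):\gamma\subset E_f,\ \gamma(0)=0,\ \gamma(1)\in\partial\mathbb D\}, \] where the infimum is over rectifiable paths, i.e. continuous maps $\gamma:[0,1]\to E_f$ of finite length $\ell(\gamma)$ with $\gamma(0)=0$ and $\gamma(1)\in\partial\mathbb D$; if no such path exists the infimum is interpreted as $+\infty$. *)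

theory Defs
  imports "HOL-Analysis.Analysis"
begin

text \<open>Length of a path on \<open>[0,1]\<close>: the supremum of the lengths of inscribed polygons over
  all partitions \<open>0 = t\<^sub>0 \<le> \<dots> \<le> t\<^sub>N = 1\<close>; it is \<open>\<infinity>\<close> for non-rectifiable paths.\<close>

definition path_length :: "(real \<Rightarrow> 'a::metric_space) \<Rightarrow> ereal" where
  "path_length g =
     (SUP (N, t) \<in> {(N :: nat, t :: nat \<Rightarrow> real). t 0 = 0 \<and> t N = 1 \<and> mono_on {..N} t}.
        ereal (\<Sum>i<N. dist (g (t i)) (g (t (Suc i)))))"

definition rectifiable_path :: "(real \<Rightarrow> 'a::metric_space) \<Rightarrow> bool" where
  "rectifiable_path g \<longleftrightarrow> path g \<and> path_length g < \<infinity>"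

definition monic_disc_polys :: "nat \<Rightarrow> complex poly set" where
  "monic_disc_polys n = {\<Prod>j=1..n. [:- a j, 1:] | a. \<forall>j\<in>{1..n}. cmod (a j) \<le> 1}"

definition lemniscate_disc :: "complex poly \<Rightarrow> complex set" where
  "lemniscate_disc f = {z. cmod z \<le> 1 \<and> cmod (poly f z) \<le> 1}"

definition escape_paths :: "complex poly \<Rightarrow> (real \<Rightarrow> complex) set" where
  "escape_paths f = {\<gamma>. rectifiable_path \<gamma> \<and> path_image \<gamma> \<subseteq> lemniscate_disc f \<and>
                        pathstart \<gamma> = 0 \<and> pathfinish \<gamma> \<in> sphere 0 1}"

text \<open>In \<^typ>\<open>ereal\<close> the infimum over an empty set of paths is \<open>\<infinity>\<close>, as intended.\<close>

definition escape_length :: "nat \<Rightarrow> ereal" where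
  "escape_length n = (SUP f \<in> monic_disc_polys n. INF \<gamma> \<in> escape_paths f. path_length \<gamma>)"

end

theory Submission
  imports Defs "HOL-Complex_Analysis.Complex_Analysis" "HOL-Computational_Algebra.Fundamental_Theorem_Algebra"
begin

text \<open>
  Upper bound. Put \<open>F(z) = \<Prod>(1 - cnj a\<^sub>j z)\<close>, so that \<open>\<bar>f\<bar> \<le> \<bar>F\<bar>\<close> on the disc, \<open>F(0) = 1\<close> and \<open>F\<close>
  has no zeros in the open disc. After an arbitrarily short segment from \<open>0\<close> along which \<open>\<bar>F\<bar>\<close>
  decreases, lift through \<open>F\<close> a straight segment that ends close to \<open>0\<close> and avoids the critical
  values. The lift lies on an algebraic curve \<open>Im (c (F - w)) = 0\<close>, which meets almost every line in
  at most \<open>n\<close> points, so the Cauchy--Crofton formula bounds its length inside the disc by \<open>\<pi> n\<close>.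
  The lift leaves the disc or ends close to a zero of \<open>F\<close>, which lies outside the open disc.

  Lower bound. Consider a labyrinth of \<open>N\<close> concentric rings, each with one gap, on alternating
  sides; every path from \<open>0\<close> to the circle which avoids the rings has length at least \<open>(N - 1)/4\<close>.
  Runge's pole pushing along a path through the labyrinth, in \<open>O(N\<^sup>2)\<close> steps each of which doubles
  the degree, gives a polynomial \<open>G\<close> of degree \<open>exp (O(N\<^sup>2))\<close> with \<open>G(0) = 0\<close> and
  \<open>\<bar>G - 1\<bar> \<le> 1/2\<close> on the rings. For small \<open>\<epsilon>\<close> put \<open>Q = 1 + \<epsilon> G\<close>, with reciprocal
  polynomial \<open>R\<close> of degree \<open>d\<close>; the polynomial \<open>Q + z\<^bsup>n-d\<^esup> R\<close> is monic of degree \<open>n\<close> with all its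
  zeros in the closed disc, and it has modulus greater than \<open>1\<close> on the rings.
\<close>

section \<open>Lengths of lifted segments\<close>

text \<open>The sample points run over monotone families in \<open>T\<close> with no prescribed
  endpoints, so a bound passes to subsets of \<open>T\<close>, to monotone reparametrisations and to
  unions of adjacent intervals.\<close>

definition length_le :: "(real \<Rightarrow> 'a::metric_space) \<Rightarrow> real set \<Rightarrow> real \<Rightarrow> bool" where
  "length_le g T L \<longleftrightarrow> (\<forall>N t. mono_on {..N} t \<longrightarrow> t ` {..N} \<subseteq> T \<longrightarrow>
     (\<Sum>i<N. dist (g (t i)) (g (t (Suc i)))) \<le> L)"

lemma length_leD:
  assumes "length_le g T L" "mono_on {..N} t" "t ` {..N} \<subseteq> T"
  shows "(\<Sum>i<N. dist (g (t i)) (g (t (Suc i)))) \<le> L"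
  using assms unfolding length_le_def by blast

lemma path_length_le:
  assumes "length_le g {0..1} L"
  shows "path_length g \<le> ereal L"
  unfolding path_length_def
proof (rule SUP_least, clarify)
  fix N and t :: "nat \<Rightarrow> real" assume t: "t 0 = 0" "t N = 1" "mono_on {..N} t"
  have "t i \<in> {0..1}" if "i \<le> N" for i
    using mono_onD[OF t(3), of 0 i] mono_onD[OF t(3), of i N] t(1,2) that by simp
  then show "ereal (\<Sum>i<N. dist (g (t i)) (g (t (Suc i)))) \<le> ereal L"
    using length_leD[OF assms t(3)] by force
qed

lemma length_le_reparam:
  assumes g: "length_le g T L" and p: "mono_on S p" "p ` S \<subseteq> T" "\<And>x. x \<in> S \<Longrightarrow> h x = g (p x)"
  shows "length_le h S L"
  unfolding length_le_def
proof (intro allI impI)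
  fix N and t :: "nat \<Rightarrow> real" assume t: "mono_on {..N} t" "t ` {..N} \<subseteq> S"
  have "(\<Sum>i<N. dist (h (t i)) (h (t (Suc i)))) = (\<Sum>i<N. dist (g (p (t i))) (g (p (t (Suc i)))))"
    using t(2) by (intro sum.cong) (auto simp: p(3) image_subset_iff)
  also have "\<dots> \<le> L"
    using length_leD[OF g, of N "\<lambda>i. p (t i)"] t p(1,2)
    by (force simp: mono_on_def image_subset_iff)
  finally show "(\<Sum>i<N. dist (h (t i)) (h (t (Suc i)))) \<le> L" .
qed

lemma length_le_join:
  assumes "length_le g {a..b} L1" "length_le g {b..c} L2" "a \<le> b" "b \<le> c"
  shows "length_le g {a..c} (L1 + L2)"
  unfolding length_le_def
proof (intro allI impI)
  fix N and t :: "nat \<Rightarrow> real" assume t: "mono_on {..N} t" "t ` {..N} \<subseteq> {a..c}"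
  \<comment> \<open>Clipping the sample points at \<open>b\<close> from above and from below gives
    one family in each half. A step on one side of \<open>b\<close> is unchanged in one sum and
    contributes \<open>0\<close> to the other; a step across \<open>b\<close> is split by the
    triangle inequality.\<close>
  have "(\<Sum>i<N. dist (g (t i)) (g (t (Suc i)))) \<le>
      (\<Sum>i<N. dist (g (min (t i) b)) (g (min (t (Suc i)) b)) + dist (g (max (t i) b)) (g (max (t (Suc i)) b)))"
  proof (rule sum_mono)
    fix i assume "i \<in> {..<N}"
    then have "t i \<le> t (Suc i)" using t(1) by (auto simp: mono_on_def)
    then consider "t (Suc i) \<le> b" | "b \<le> t i" | "t i \<le> b" "b \<le> t (Suc i)" by linarith
    then show "dist (g (t i)) (g (t (Suc i))) \<le>
        dist (g (min (t i) b)) (g (min (t (Suc i)) b)) + dist (g (max (t i) b)) (g (max (t (Suc i)) b))"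
      using \<open>t i \<le> t (Suc i)\<close>
      by cases (auto simp: min_absorb1 min_absorb2 max_absorb1 max_absorb2 dist_triangle)
  qed
  also have "\<dots> = (\<Sum>i<N. dist (g (min (t i) b)) (g (min (t (Suc i)) b))) +
      (\<Sum>i<N. dist (g (max (t i) b)) (g (max (t (Suc i)) b)))" by (rule sum.distrib)
  also have "\<dots> \<le> L1 + L2"
    using t assms(3,4)
    by (intro add_mono length_leD[OF assms(1)] length_leD[OF assms(2)])
       (force simp: mono_on_def min_def max_def image_subset_iff)+
  finally show "(\<Sum>i<N. dist (g (t i)) (g (t (Suc i)))) \<le> L1 + L2" .
qed

lemma length_le_linepath: "length_le (linepath z w) {0..1} (dist z w)" for z w :: "'a::real_normed_vector"
  unfolding length_le_def
proof (intro allI impI)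
  fix N and t :: "nat \<Rightarrow> real" assume t: "mono_on {..N} t" "t ` {..N} \<subseteq> {0..1}"
  have "(\<Sum>i<N. dist (linepath z w (t i)) (linepath z w (t (Suc i)))) = (\<Sum>i<N. (t (Suc i) - t i) * dist z w)"
  proof (rule sum.cong[OF refl])
    fix i assume "i \<in> {..<N}"
    then have "t i \<le> t (Suc i)" using t(1) by (auto simp: mono_on_def)
    moreover have "linepath z w (t i) - linepath z w (t (Suc i)) = (t (Suc i) - t i) *\<^sub>R (z - w)"
      by (simp add: linepath_def algebra_simps)
    ultimately show "dist (linepath z w (t i)) (linepath z w (t (Suc i))) = (t (Suc i) - t i) * dist z w"
      by (simp add: dist_norm)
  qed
  also have "\<dots> = (t N - t 0) * dist z w" by (simp add: sum_distrib_right[symmetric] sum_lessThan_telescope)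
  also have "\<dots> \<le> 1 * dist z w"
  proof (rule mult_right_mono)
    have "t N \<in> {0..1}" "t 0 \<in> {0..1}" using t(2) by (auto simp: image_subset_iff)
    then show "t N - t 0 \<le> 1" by simp
  qed simp
  finally show "(\<Sum>i<N. dist (linepath z w (t i)) (linepath z w (t (Suc i)))) \<le> dist z w" by simp
qed

text \<open>Banach indicatrix: the variation is the integral over \<open>p\<close> of the number of solutions of \<open>g x = p\<close>.\<close>

lemma variation_le_multiplicity:
  fixes g :: "real \<Rightarrow> real"
  assumes cont: "continuous_on {a..b} g" and range: "g ` {a..b} \<subseteq> {-1..1}"
    and mult: "\<And>p. finite {x \<in> {a..b}. g x = p} \<and> card {x \<in> {a..b}. g x = p} \<le> n"
  shows "length_le g {a..b} (2 * real n)"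
  unfolding length_le_def
proof (intro allI impI)
  fix N and t :: "nat \<Rightarrow> real" assume t: "mono_on {..N} t" "t ` {..N} \<subseteq> {a..b}"
  define I where "I i = {min (g (t i)) (g (t (Suc i)))<..<max (g (t i)) (g (t (Suc i)))}" for i
  have tin: "i \<le> N \<Longrightarrow> t i \<in> {a..b}" for i using t(2) by auto
  \<comment> \<open>By the intermediate value theorem each \<open>I i\<close> containing
    \<open>p\<close> yields a solution of \<open>g x = p\<close>. As \<open>I i\<close> is open, the
    solution is interior to its parameter interval, so different \<open>i\<close> give different
    solutions and at most \<open>n\<close> of the \<open>I i\<close> contain
    \<open>p\<close>.\<close>
  have pw: "(\<Sum>i<N. indicator (I i) p) \<le> (of_nat n * indicator {-1..1} p :: ennreal)" for p
  proof -
    define J where "J = {i. i < N \<and> p \<in> I i}"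
    have "\<exists>x. t i < x \<and> x < t (Suc i) \<and> g x = p" if "i \<in> J" for i
    proof -
      have i: "Suc i \<le> N" and p: "p \<in> I i" using that by (auto simp: J_def)
      have le: "t i \<le> t (Suc i)" using t(1) i by (auto simp: mono_on_def)
      have c: "continuous_on {t i..t (Suc i)} g"
        by (rule continuous_on_subset[OF cont]) (use tin[of i] tin[of "Suc i"] i in auto)
      have "\<exists>x. t i \<le> x \<and> x \<le> t (Suc i) \<and> g x = p"
      proof (cases "g (t i) \<le> p")
        case True
        then have "p \<le> g (t (Suc i))" using p by (auto simp: I_def max_def split: if_splits)
        then show ?thesis using IVT'[OF True _ le c] by blast
      next
        case False
        then have "g (t (Suc i)) \<le> p" "p \<le> g (t i)" using p by (auto simp: I_def min_def split: if_splits)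
        then show ?thesis using IVT2'[OF _ _ le c, of p] by blast
      qed
      then obtain x where x: "t i \<le> x" "x \<le> t (Suc i)" "g x = p" by blast
      have "x \<noteq> t i" "x \<noteq> t (Suc i)" using x p by (auto simp: I_def)
      with x show ?thesis by (auto intro!: exI[of _ x])
    qed
    then obtain \<xi> where \<xi>: "\<And>i. i \<in> J \<Longrightarrow> t i < \<xi> i \<and> \<xi> i < t (Suc i) \<and> g (\<xi> i) = p" by metis
    have lt: "\<xi> i < \<xi> j" if "i \<in> J" "j \<in> J" "i < j" for i j
    proof -
      have "t (Suc i) \<le> t j" using t(1) that by (auto simp: mono_on_def J_def)
      then show ?thesis using \<xi>[OF that(1)] \<xi>[OF that(2)] by linarith
    qed
    then have "inj_on \<xi> J" by (intro inj_onI) (metis less_irrefl linorder_neqE_nat)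
    moreover have sub: "\<xi> ` J \<subseteq> {x \<in> {a..b}. g x = p}"
    proof
      fix x assume "x \<in> \<xi> ` J"
      then obtain i where i: "i \<in> J" "x = \<xi> i" by auto
      then have "Suc i \<le> N" by (simp add: J_def)
      then have "t i \<in> {a..b}" "t (Suc i) \<in> {a..b}" using tin[of i] tin[of "Suc i"] by simp_all
      then show "x \<in> {x \<in> {a..b}. g x = p}" using \<xi>[OF i(1)] i(2) by auto
    qed
    ultimately have card: "card J \<le> n" using mult[of p] card_inj_on_le order_trans by blast
    have J: "(\<Sum>i<N. indicator (I i) p) = (of_nat (card J) :: ennreal)"
    proof -
      have "(\<Sum>i<N. indicator (I i) p) = (\<Sum>i\<in>J. 1::ennreal)"
        by (rule sum.mono_neutral_cong_right) (auto simp: J_def)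
      then show ?thesis by simp
    qed
    show ?thesis
    proof (cases "J = {}")
      case False
      then obtain i where "i \<in> J" by blast
      then have "p \<in> {-1..1}" using sub range \<xi> by blast
      then show ?thesis unfolding J using card by simp
    qed (simp add: J)
  qed
  \<comment> \<open>The increments are the lengths of the \<open>I i\<close>; integrating
    \<open>pw\<close> over an interval of length \<open>2\<close> gives
    \<open>2 * n\<close>.\<close>
  have "emeasure lborel (I i) = ennreal (dist (g (t i)) (g (t (Suc i))))" for i
    by (auto simp: I_def dist_real_def max_def min_def)
  then have "ennreal (\<Sum>i<N. dist (g (t i)) (g (t (Suc i)))) = (\<Sum>i<N. emeasure lborel (I i))"
    by simp
  also have "\<dots> = (\<integral>\<^sup>+p. (\<Sum>i<N. indicator (I i) p) \<partial>lborel)"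
    by (subst nn_integral_sum) (auto simp: I_def)
  also have "\<dots> \<le> (\<integral>\<^sup>+p. of_nat n * indicator {-1..1::real} p \<partial>lborel)"
    by (rule nn_integral_mono) (rule pw)
  also have "\<dots> = of_nat n * 2" by (subst nn_integral_cmult_indicator) auto
  also have "\<dots> = ennreal (2 * real n)" by (simp add: ennreal_mult ennreal_of_nat_eq_real_of_nat mult.commute)
  finally show "(\<Sum>i<N. dist (g (t i)) (g (t (Suc i)))) \<le> 2 * real n" by (simp add: ennreal_le_iff)
qed

section \<open>Length from projections onto lines\<close>

text \<open>With \<open>\<alpha>\<close> the argument of \<open>v\<close>, the integrand is
  \<open>cmod v\<close> times the modulus of \<open>cos (\<phi> - \<alpha>)\<close>. Splitting at a
  zero \<open>b\<close> of this cosine, where the sine is \<open>1\<close> or \<open>-1\<close>,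
  bounds the integral below by two increments of the sine; they add up to \<open>2\<close> because
  the sine takes opposite values at \<open>0\<close> and \<open>pi\<close>.\<close>

lemma cauchy_crofton_vector:
  "2 * cmod v \<le> integral {0..pi} (\<lambda>\<phi>. \<bar>Re (cis (-\<phi>) * v)\<bar>)"
proof -
  define \<alpha> where "\<alpha> = Arg v"
  have v: "v = of_real (cmod v) * cis \<alpha>" using rcis_cmod_Arg[of v] by (simp add: rcis_def \<alpha>_def)
  have re: "Re (cis (-\<phi>) * v) = cmod v * cos (\<phi> - \<alpha>)" for \<phi>
    by (subst v) (simp add: cos_diff algebra_simps)
  define c where "c \<phi> = \<bar>cos (\<phi> - \<alpha>)\<bar>" for \<phi>
  have cint: "c integrable_on {x..y}" for x y
    unfolding c_def by (intro integrable_continuous_real continuous_intros)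
  have prim: "((\<lambda>\<phi>. cos (\<phi> - \<alpha>)) has_integral (sin (y - \<alpha>) - sin (x - \<alpha>))) {x..y}" if "x \<le> y" for x y
    by (rule fundamental_theorem_of_calculus[OF that, of "\<lambda>\<phi>. sin (\<phi> - \<alpha>)"])
       (auto intro!: derivative_eq_intros simp: has_real_derivative_iff_has_vector_derivative[symmetric])
  have low: "\<bar>sin (y - \<alpha>) - sin (x - \<alpha>)\<bar> \<le> integral {x..y} c" if "x \<le> y" for x y
  proof -
    have "norm (integral {x..y} (\<lambda>\<phi>. cos (\<phi> - \<alpha>))) \<le> integral {x..y} c"
      using prim[OF that] by (intro integral_norm_bound_integral cint) (auto simp: c_def)
    then show ?thesis using integral_unique[OF prim[OF that]] by simp
  qed
  have "\<exists>b. 0 \<le> b \<and> b \<le> pi \<and> cos (b - \<alpha>) = 0"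
  proof (cases "cos (0 - \<alpha>) \<le> 0")
    case True
    have "0 \<le> cos (pi - \<alpha>)" using True by (simp add: cos_diff)
    then show ?thesis using True by (intro IVT') (auto intro!: continuous_intros)
  next
    case False
    have "cos (pi - \<alpha>) \<le> 0" using False by (simp add: cos_diff)
    then show ?thesis using False by (intro IVT2') (auto intro!: continuous_intros)
  qed
  then obtain b where b: "0 \<le> b" "b \<le> pi" "cos (b - \<alpha>) = 0" by blast
  have "(sin (b - \<alpha>))^2 = 1" using sin_squared_eq[of "b - \<alpha>"] b(3) by simp
  then have "sin (b - \<alpha>) = 1 \<or> sin (b - \<alpha>) = -1" by (simp add: power2_eq_1_iff)
  moreover have "sin (pi - \<alpha>) = - sin (0 - \<alpha>)" by (simp add: sin_diff)
  moreover have "\<bar>sin (0 - \<alpha>)\<bar> \<le> 1" by (rule abs_sin_le_one)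
  ultimately have "2 \<le> \<bar>sin (b - \<alpha>) - sin (0 - \<alpha>)\<bar> + \<bar>sin (pi - \<alpha>) - sin (b - \<alpha>)\<bar>" by linarith
  also have "\<dots> \<le> integral {0..b} c + integral {b..pi} c" by (intro add_mono low b)
  also have "\<dots> = integral {0..pi} c" by (rule Henstock_Kurzweil_Integration.integral_combine[OF b(1,2) cint])
  finally have "cmod v * 2 \<le> cmod v * integral {0..pi} c" by (intro mult_left_mono) auto
  also have "\<dots> = integral {0..pi} (\<lambda>\<phi>. \<bar>Re (cis (-\<phi>) * v)\<bar>)"
    unfolding re by (simp add: c_def[abs_def] abs_mult)
  finally show ?thesis by simp
qed

text \<open>If \<open>C * u\<close> is real and \<open>u\<close> has modulus \<open>1\<close>,
  equating it with its conjugate gives \<open>C * u^2 = cnj C\<close>. With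
  \<open>u = cis \<phi> ^ d\<close> this is a polynomial equation for \<open>cis \<phi>\<close>, and
  \<open>cis\<close> is injective on \<open>[0, pi]\<close>.\<close>

lemma finite_real_directions:
  assumes "C \<noteq> 0" "0 < d"
  shows "finite {\<phi> \<in> {0..pi}. Im (C * cis \<phi> ^ d) = 0}"
proof -
  define q where "q = monom C (2 * d) - [:cnj C:]"
  have "coeff q (2 * d) = C" using assms(2) by (simp add: q_def coeff_pCons split: nat.splits)
  then have "q \<noteq> 0" using assms(1) by auto
  then have fin: "finite {u. poly q u = 0}" by (rule poly_roots_finite)
  have "cis ` {\<phi> \<in> {0..pi}. Im (C * cis \<phi> ^ d) = 0} \<subseteq> {u. poly q u = 0}"
  proof clarify
    fix \<phi> assume im: "Im (C * cis \<phi> ^ d) = 0"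
    let ?u = "cis \<phi> ^ d"
    have u: "cnj ?u * ?u = 1" by (simp add: complex_cnj_power cis_cnj power_mult_distrib[symmetric] cis_mult)
    have "C * ?u = cnj (C * ?u)" using im by (metis Reals_cnj_iff complex_is_Real_iff)
    then have "C * ?u * ?u = cnj C * (cnj ?u * ?u)" by (simp only: complex_cnj_mult mult.assoc)
    then have "C * (?u * ?u) = cnj C" by (simp only: u mult.assoc mult_1_right)
    then show "poly q (cis \<phi>) = 0" by (simp add: q_def poly_monom mult_2 power_add)
  qed
  then have "finite (cis ` {\<phi> \<in> {0..pi}. Im (C * cis \<phi> ^ d) = 0})" using fin finite_subset by blast
  moreover have "inj_on cis {\<phi> \<in> {0..pi}. Im (C * cis \<phi> ^ d) = 0}"
    by (rule inj_onI) (auto simp: complex_eq_iff intro: cos_inj_pi)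
  ultimately show ?thesis by (rule finite_imageD)
qed

text \<open>On the real axis a polynomial minus its coefficientwise conjugate equals
  \<open>2 * \<i>\<close> times its imaginary part. The condition \<open>good\<close> keeps the
  coefficient of order \<open>degree F\<close> of this difference nonzero, so the number of its
  roots is bounded by the degree.\<close>

lemma card_real_values_on_line:
  fixes F :: "complex poly"
  assumes deg: "0 < degree F" and good: "Im (c * lead_coeff F * b ^ degree F) \<noteq> 0"
  shows "finite {y::real. Im (c * (poly F (a + b * of_real y) - w)) = 0}"
    and "card {y::real. Im (c * (poly F (a + b * of_real y) - w)) = 0} \<le> degree F"
proof -
  define A where "A = smult c (pcompose F [:a, b:] - [:w:])"
  define B where "B = A - map_poly cnj A"
  have Ay: "poly A (of_real y) = c * (poly F (a + b * of_real y) - w)" for y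
    by (simp add: A_def poly_pcompose algebra_simps)
  have By: "poly B (of_real y) = 0 \<longleftrightarrow> Im (c * (poly F (a + b * of_real y) - w)) = 0" for y
  proof -
    have "poly (map_poly cnj A) (of_real y) = cnj (poly A (of_real y))" using poly_cnj[of A "of_real y"] by simp
    then have "poly B (of_real y) = poly A (of_real y) - cnj (poly A (of_real y))" by (simp add: B_def)
    then show ?thesis unfolding Ay[symmetric] by (simp add: complex_eq_iff)
  qed
  have b: "degree [:a, b:] = 1" using good deg by (auto simp: power_0_left)
  then have "coeff (pcompose F [:a, b:]) (degree F) = lead_coeff F * b ^ degree F"
    using lead_coeff_comp[of "[:a, b:]" F] by (simp add: degree_pcompose)
  then have "coeff A (degree F) = c * lead_coeff F * b ^ degree F"
    using deg by (simp add: A_def coeff_pCons split: nat.splits)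
  then have "Im (coeff A (degree F)) \<noteq> 0" using good by simp
  moreover have "Im (coeff B (degree F)) = 2 * Im (coeff A (degree F))" by (simp add: B_def coeff_map_poly)
  ultimately have "coeff B (degree F) \<noteq> 0" by auto
  then have B0: "B \<noteq> 0" by auto
  have "degree A \<le> degree F" unfolding A_def
    by (intro order_trans[OF degree_smult_le] degree_diff_le order_trans[OF degree_pcompose_le]) auto
  moreover have "degree (map_poly cnj A) = degree A" by (rule degree_map_poly) auto
  ultimately have degB: "degree B \<le> degree F" unfolding B_def by (intro degree_diff_le) auto
  let ?Y = "{y::real. Im (c * (poly F (a + b * of_real y) - w)) = 0}"
  have sub: "of_real ` ?Y \<subseteq> {u. poly B u = 0}" using By by auto
  have inj: "inj_on (of_real :: real \<Rightarrow> complex) ?Y" by (simp add: inj_on_def)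
  have fin: "finite {u. poly B u = 0}" by (rule poly_roots_finite[OF B0])
  show "finite ?Y" using finite_imageD[OF finite_subset[OF sub fin] inj] .
  have "card ?Y = card (of_real ` ?Y :: complex set)" using card_image[OF inj] by simp
  also have "\<dots> \<le> card {u. poly B u = 0}" by (rule card_mono[OF fin sub])
  also have "\<dots> \<le> degree B" by (rule card_poly_roots_bound[OF B0])
  finally show "card ?Y \<le> degree F" using degB by linarith
qed

text \<open>For all but finitely many directions the projection of \<open>g\<close> takes each value
  at most \<open>n\<close> times, hence has variation at most \<open>2 * n\<close>, as the disc has
  width \<open>2\<close>. Averaging over the directions bounds the length.\<close>

lemma length_le_lift_of_segment:
  fixes F :: "complex poly"
  assumes deg: "0 < degree F" "degree F \<le> n" and w: "w \<noteq> 0"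
    and cont: "continuous_on {a..b} g" and disc: "\<And>t. t \<in> {a..b} \<Longrightarrow> cmod (g t) \<le> 1"
    and lift: "\<And>t. t \<in> {a..b} \<Longrightarrow> poly F (g t) = w0 + of_real t * w"
  shows "length_le g {a..b} (pi * real n)"
  unfolding length_le_def
proof (intro allI impI)
  fix N and t :: "nat \<Rightarrow> real" assume t: "mono_on {..N} t" "t ` {..N} \<subseteq> {a..b}"
  define v where "v i = g (t (Suc i)) - g (t i)" for i
  define S where "S \<phi> = (\<Sum>i<N. \<bar>Re (cis (-\<phi>) * v i)\<bar>)" for \<phi>
  \<comment> \<open>The lines orthogonal to \<open>cis \<phi>\<close> have direction
    \<open>\<i> * cis \<phi>\<close>; \<open>Z\<close> collects the exceptional
    \<open>\<phi>\<close> for which \<open>card_real_values_on_line\<close> does not apply to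
    them.\<close>
  define C where "C = cnj w * lead_coeff F * \<i> ^ degree F"
  define Z where "Z = {\<phi> \<in> {0..pi}. Im (C * cis \<phi> ^ degree F) = 0}"
  have "F \<noteq> 0" using deg by auto
  then have "C \<noteq> 0" using w by (simp add: C_def)
  then have finZ: "finite Z" unfolding Z_def using finite_real_directions deg(1) by blast
  have bound: "S \<phi> \<le> 2 * real n" if \<phi>: "\<phi> \<in> {0..pi} - Z" for \<phi>
  proof -
    have good: "Im (cnj w * lead_coeff F * (\<i> * cis \<phi>) ^ degree F) \<noteq> 0"
      using \<phi> by (simp add: Z_def C_def power_mult_distrib mult.assoc)
    define h where "h s = Re (cis (-\<phi>) * g s)" for s
    have "length_le h {a..b} (2 * real n)"
    proof (rule variation_le_multiplicity)
      show "continuous_on {a..b} h" unfolding h_def by (intro continuous_intros cont)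
      show "h ` {a..b} \<subseteq> {-1..1}"
      proof clarify
        fix s assume "s \<in> {a..b}"
        then have "\<bar>h s\<bar> \<le> 1" using abs_Re_le_cmod[of "cis (-\<phi>) * g s"] disc[of s] by (simp add: h_def norm_mult)
        then show "h s \<in> {-1..1}" by auto
      qed
      fix p
      let ?X = "{s \<in> {a..b}. h s = p}"
      let ?Y = "{y::real. Im (cnj w * (poly F (cis \<phi> * of_real p + \<i> * cis \<phi> * of_real y) - w0)) = 0}"
      define y where "y s = Im (cis (-\<phi>) * g s)" for s
      have gs: "g s = cis \<phi> * of_real p + \<i> * cis \<phi> * of_real (y s)" if "s \<in> ?X" for s
      proof -
        have "cis (-\<phi>) * g s = of_real p + \<i> * of_real (y s)"
          using that by (simp add: y_def h_def complex_eq_iff)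
        then have "cis \<phi> * (cis (-\<phi>) * g s) = cis \<phi> * of_real p + \<i> * cis \<phi> * of_real (y s)"
          by (simp add: algebra_simps)
        then show ?thesis by (simp add: mult.assoc[symmetric] cis_mult)
      qed
      \<comment> \<open>Along the lift \<open>poly F\<close> is an injective function of the
        parameter, so distinct parameters give distinct points of the line.\<close>
      have inj: "inj_on y ?X"
      proof (rule inj_onI)
        fix s s' assume s: "s \<in> ?X" "s' \<in> ?X" "y s = y s'"
        then have "g s = g s'" using gs by simp
        then have "w0 + of_real s * w = w0 + of_real s' * w" using lift s by (metis (mono_tags, lifting) mem_Collect_eq)
        then show "s = s'" using w by simp
      qed
      \<comment> \<open>\<open>poly F (g s) - w0\<close> is a real multiple of \<open>w\<close> and
        becomes real after multiplication by \<open>cnj w\<close>.\<close>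
      have sub: "y ` ?X \<subseteq> ?Y"
      proof clarify
        fix s assume s: "s \<in> {a..b}" "p = h s"
        then have sX: "s \<in> ?X" by simp
        have "poly F (g s) - w0 = of_real s * w" using lift s by simp
        moreover have "Im (cnj w * (of_real s * w)) = 0" by simp
        ultimately show "Im (cnj w * (poly F (cis \<phi> * of_real (h s) + \<i> * cis \<phi> * of_real (y s)) - w0)) = 0"
          unfolding gs[OF sX, unfolded s(2), symmetric] by presburger
      qed
      note Y = card_real_values_on_line[OF deg(1) good, of "cis \<phi> * of_real p" w0]
      have "finite ?X" using finite_imageD[OF finite_subset[OF sub Y(1)] inj] .
      moreover have "card ?X \<le> card ?Y" by (rule card_inj_on_le[OF inj sub Y(1)])
      ultimately show "finite ?X \<and> card ?X \<le> n" using Y(2) deg(2) by linarith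
    qed
    from length_leD[OF this t] show ?thesis
      by (simp add: S_def v_def h_def dist_real_def right_diff_distrib abs_minus_commute)
  qed
  have int: "(\<lambda>\<phi>. \<bar>Re (cis (-\<phi>) * v i)\<bar>) integrable_on {0..pi}" for i
    by (intro integrable_continuous_real continuous_intros)
  have "2 * (\<Sum>i<N. dist (g (t i)) (g (t (Suc i)))) = (\<Sum>i<N. 2 * cmod (v i))"
    by (simp add: sum_distrib_left dist_norm norm_minus_commute v_def)
  also have "\<dots> \<le> (\<Sum>i<N. integral {0..pi} (\<lambda>\<phi>. \<bar>Re (cis (-\<phi>) * v i)\<bar>))"
    by (intro sum_mono cauchy_crofton_vector)
  also have "\<dots> = integral {0..pi} S" unfolding S_def by (rule integral_sum[symmetric]) (rule finite_lessThan int)+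
  also have "\<dots> = integral {0..pi} (\<lambda>\<phi>. if \<phi> \<in> Z then 0 else S \<phi>)"
    by (rule integral_spike[OF negligible_finite[OF finZ]]) auto
  also have "\<dots> \<le> integral {0..pi} (\<lambda>\<phi>. 2 * real n)"
  proof (rule integral_le)
    have "S integrable_on {0..pi}" unfolding S_def by (rule integrable_sum) (rule finite_lessThan int)+
    then show "(\<lambda>\<phi>. if \<phi> \<in> Z then 0 else S \<phi>) integrable_on {0..pi}"
      by (rule integrable_spike[OF _ negligible_finite[OF finZ]]) auto
  qed (use bound in auto)
  finally show "(\<Sum>i<N. dist (g (t i)) (g (t (Suc i)))) \<le> pi * real n" by simp
qed

section \<open>Lifting segments through polynomials\<close>

text \<open>Nonconstant polynomials tend to infinity at infinity, so they are proper maps.\<close>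

lemma compact_vimage_poly:
  fixes F :: "complex poly"
  assumes "0 < degree F" "compact S"
  shows "compact {z. poly F z \<in> S}"
proof -
  obtain B where B: "\<And>x. x \<in> S \<Longrightarrow> cmod x \<le> B"
    using compact_imp_bounded[OF assms(2)] by (auto simp: bounded_iff)
  obtain a p where F: "F = pCons a p" by (cases F)
  then have "p \<noteq> 0" using assms(1) by auto
  then obtain r where r: "\<And>z. r \<le> cmod z \<Longrightarrow> B + 1 \<le> cmod (poly F z)"
    using poly_infinity[of p "B + 1" a] F by blast
  have "cmod z \<le> r" if "poly F z \<in> S" for z
    using B[OF that] r[of z] by linarith
  then have "bounded {z. poly F z \<in> S}" by (auto simp: bounded_iff)
  moreover have "closed (poly F -` S)"
    by (rule continuous_closed_vimage) (use assms(2) compact_imp_closed in \<open>auto intro!: continuous_intros\<close>)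
  ultimately show ?thesis by (simp add: compact_eq_bounded_closed vimage_def)
qed

text \<open>The inverse function theorem with one radius \<open>d\<close> that serves all
  \<open>y\<close> near \<open>z\<close>; this uniformity is what a compactness argument
  needs.\<close>

lemma local_section:
  fixes F :: "complex poly"
  assumes "poly (pderiv F) z \<noteq> 0"
  obtains U d where "open U" "z \<in> U" "0 < d"
    "\<And>y. y \<in> U \<Longrightarrow> \<exists>g. continuous_on (ball (poly F y) d) g \<and> g (poly F y) = y \<and>
        (\<forall>u\<in>ball (poly F y) d. poly F (g u) = u)"
proof -
  have hol: "poly F holomorphic_on UNIV" by (intro holomorphic_intros)
  have "deriv (poly F) z \<noteq> 0" using assms by (simp add: DERIV_imp_deriv[OF poly_DERIV])
  then obtain r where r: "0 < r" "open (poly F ` ball z r)" "inj_on (poly F) (ball z r)"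
    using has_complex_derivative_locally_invertible[OF hol, of z] by auto
  obtain h where h: "h holomorphic_on (poly F ` ball z r)" "\<And>y. y \<in> ball z r \<Longrightarrow> h (poly F y) = y"
    using holomorphic_has_inverse[OF _ _ r(3)] by (metis hol holomorphic_on_subset open_ball subset_UNIV)
  obtain d where d: "0 < d" "ball (poly F z) d \<subseteq> poly F ` ball z r"
    using r(1,2) by (metis centre_in_ball imageI open_contains_ball)
  define U where "U = ball z r \<inter> poly F -` ball (poly F z) (d/2)"
  have "open U" unfolding U_def
    by (intro open_Int open_ball continuous_open_vimage) (auto intro!: continuous_intros)
  moreover have "z \<in> U" using r(1) d(1) by (simp add: U_def)
  moreover have "\<exists>g. continuous_on (ball (poly F y) (d/2)) g \<and> g (poly F y) = y \<and>
        (\<forall>u\<in>ball (poly F y) (d/2). poly F (g u) = u)" if y: "y \<in> U" for y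
  proof (intro exI[of _ h] conjI ballI)
    have "ball (poly F y) (d/2) \<subseteq> ball (poly F z) d"
    proof
      fix u assume "u \<in> ball (poly F y) (d/2)"
      then show "u \<in> ball (poly F z) d"
        using y dist_triangle[of "poly F z" u "poly F y"] by (simp add: U_def)
    qed
    then have sub: "ball (poly F y) (d/2) \<subseteq> poly F ` ball z r" using d(2) by blast
    show "continuous_on (ball (poly F y) (d/2)) h"
      using holomorphic_on_imp_continuous_on[OF h(1)] sub by (rule continuous_on_subset)
    show "h (poly F y) = y" using y h(2) by (simp add: U_def)
    fix u assume "u \<in> ball (poly F y) (d/2)"
    then obtain x where "x \<in> ball z r" "u = poly F x" using sub by auto
    then show "poly F (h u) = u" using h(2) by simp
  qed
  ultimately show ?thesis using that[of U "d/2"] d(1) by auto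
qed

text \<open>The preimage of the segment is compact and free of critical points, so finitely many
  neighbourhoods from \<open>local_section\<close> give one radius \<open>\<delta>\<close> for local
  inverses at all its points. The segment is lifted in \<open>m\<close> pieces shorter than
  \<open>\<delta>\<close>; each lifted piece ends in the preimage again, where the next local
  inverse is available.\<close>

lemma lift_segment:
  fixes F :: "complex poly"
  assumes deg: "0 < degree F" and z0: "poly F z0 = w0"
    and noncrit: "\<And>t z. t \<in> {0..1} \<Longrightarrow> poly F z = w0 + of_real t * w \<Longrightarrow> poly (pderiv F) z \<noteq> 0"
  obtains g where "continuous_on {0..1} g" "g 0 = z0" "\<And>t. t \<in> {0..1} \<Longrightarrow> poly F (g t) = w0 + of_real t * w"
proof -
  define l where "l t = w0 + of_real t * w" for t :: real
  have lcont: "continuous_on A l" for A unfolding l_def by (intro continuous_intros)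
  define P where "P = {z. poly F z \<in> l ` {0..1}}"
  have P: "compact P" unfolding P_def
    by (intro compact_vimage_poly[OF deg] compact_continuous_image lcont) auto
  define sec where "sec y d \<longleftrightarrow> (\<exists>g. continuous_on (ball (poly F y) d) g \<and> g (poly F y) = y \<and>
        (\<forall>u\<in>ball (poly F y) d. poly F (g u) = u))" for y d
  have "\<exists>U d. open U \<and> z \<in> U \<and> 0 < d \<and> (\<forall>y\<in>U. sec y d)" if "z \<in> P" for z
  proof -
    have "poly (pderiv F) z \<noteq> 0" using that noncrit by (auto simp: P_def l_def)
    then show ?thesis unfolding sec_def by (rule local_section) blast
  qed
  then obtain U d where U: "\<And>z. z \<in> P \<Longrightarrow> open (U z) \<and> z \<in> U z \<and> 0 < d z \<and> (\<forall>y\<in>U z. sec y (d z))" by metis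
  have "P \<subseteq> (\<Union>z\<in>P. U z)" using U by auto
  then obtain C where C: "C \<subseteq> P" "finite C" "P \<subseteq> (\<Union>z\<in>C. U z)"
    using compactE_image[OF P, of P U] U by metis
  define \<delta> where "\<delta> = Min (insert 1 (d ` C))"
  have \<delta>: "0 < \<delta>" unfolding \<delta>_def using C U by (auto simp: subset_iff)
  have sec: "sec y \<delta>" if yP: "y \<in> P" for y
  proof -
    obtain z where z: "z \<in> C" "y \<in> U z" using C(3) yP by blast
    then have "sec y (d z)" using U C(1) by blast
    moreover have "\<delta> \<le> d z" unfolding \<delta>_def using z(1) C(2) by (intro Min_le) auto
    then have "ball (poly F y) \<delta> \<subseteq> ball (poly F y) (d z)" by (rule subset_ball)
    ultimately show ?thesis unfolding sec_def by (meson continuous_on_subset subsetD)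
  qed
  obtain m :: nat where m: "cmod w / \<delta> < real m" using reals_Archimedean2 by blast
  then have m0: "0 < real m" using \<delta> by (smt (verit) divide_nonneg_pos norm_ge_zero)
  have "\<exists>g. continuous_on {0..real i / real m} g \<and> g 0 = z0 \<and> (\<forall>t\<in>{0..real i / real m}. poly F (g t) = l t)"
    if "i \<le> m" for i
    using that
  proof (induction i)
    case 0
    show ?case by (rule exI[of _ "\<lambda>_. z0"]) (auto simp: l_def z0)
  next
    case (Suc i)
    let ?a = "real i / real m" and ?b = "real (Suc i) / real m"
    obtain g where g: "continuous_on {0..?a} g" "g 0 = z0" "\<And>t. t \<in> {0..?a} \<Longrightarrow> poly F (g t) = l t"
      using Suc by auto
    have a: "0 \<le> ?a" "?a \<le> ?b" "?b \<le> 1" "?b - ?a = 1 / real m"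
      using m0 Suc.prems by (auto simp: divide_right_mono diff_divide_distrib[symmetric])
    have Fa: "poly F (g ?a) = l ?a" using g(3) a by auto
    then have "g ?a \<in> P" using a by (auto simp: P_def)
    from sec[OF this] obtain h where h: "continuous_on (ball (l ?a) \<delta>) h" "h (l ?a) = g ?a"
      "\<And>u. u \<in> ball (l ?a) \<delta> \<Longrightarrow> poly F (h u) = u" unfolding sec_def Fa by blast
    have lin: "l t \<in> ball (l ?a) \<delta>" if "t \<in> {?a..?b}" for t
    proof -
      have "l ?a - l t = of_real (?a - t) * w" by (simp add: l_def algebra_simps)
      then have "dist (l ?a) (l t) = \<bar>?a - t\<bar> * cmod w" by (simp only: dist_norm norm_mult norm_of_real)
      also have "\<dots> \<le> 1 / real m * cmod w" using that a by (intro mult_right_mono) auto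
      also have "\<dots> < \<delta>" using m m0 \<delta> by (simp add: field_simps)
      finally show ?thesis by simp
    qed
    define g' where "g' t = (if t \<le> ?a then g t else h (l t))" for t
    have "continuous_on ({0..?a} \<union> {?a..?b}) g'" unfolding g'_def
    proof (rule continuous_on_cases)
      show "continuous_on {?a..?b} (\<lambda>t. h (l t))"
        by (rule continuous_on_compose2[OF h(1) lcont]) (use lin in auto)
      show "\<forall>t. t \<in> {0..?a} \<and> \<not> t \<le> ?a \<or> t \<in> {?a..?b} \<and> t \<le> ?a \<longrightarrow> g t = h (l t)"
        using h(2) by (auto dest: order.antisym)
    qed (use g(1) in auto)
    moreover have "{0..?a} \<union> {?a..?b} = {0..?b}" by (rule ivl_disj_un_two_touch(4)[OF a(1,2)])
    ultimately have "continuous_on {0..?b} g'" by simp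
    moreover have "g' 0 = z0" using g(2) a by (simp add: g'_def)
    moreover have "poly F (g' t) = l t" if "t \<in> {0..?b}" for t
      using that g(3)[of t] h(3)[OF lin[of t]] by (auto simp: g'_def)
    ultimately show ?case by blast
  qed
  from this[of m] m0 show ?thesis using that unfolding l_def by auto
qed

section \<open>Polynomials with zeros in the disc\<close>

lemma root_factor:
  fixes f :: "complex poly"
  assumes "degree f = Suc n"
  obtains b g where "f = [:-b, 1:] * g" "degree g = n" "poly f b = 0"
proof -
  have nc: "\<not> constant (poly f)" using assms by (simp add: constant_degree)
  then obtain b where b: "poly f b = 0" using Fundamental_Theorem_Algebra.fundamental_theorem_of_algebra[OF nc] by blast
  then have "[:-b, 1:] dvd f" by (simp only: poly_eq_0_iff_dvd)
  then obtain g where g: "f = [:-b, 1:] * g" by (elim dvdE)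
  with assms have "g \<noteq> 0" by auto
  then have "degree f = degree [:-b, 1:] + degree g" unfolding g by (intro degree_mult_eq) auto
  then have "degree g = n" using assms by simp
  with b g show ?thesis using that by blast
qed

lemma monic_disc_polysI:
  assumes "degree f = n" "lead_coeff f = 1" "\<And>b. poly f b = 0 \<Longrightarrow> cmod b \<le> 1"
  shows "f \<in> monic_disc_polys n"
  using assms
proof (induction n arbitrary: f)
  case 0
  then have "f = 1" using degree_eq_zeroE[of f] by (metis coeff_pCons_0 one_pCons)
  then show ?case by (auto simp: monic_disc_polys_def)
next
  case (Suc n)
  obtain b g where g: "f = [:-b, 1:] * g" "degree g = n" "poly f b = 0"
    using root_factor[OF Suc.prems(1)] .
  have "lead_coeff g = 1" using Suc.prems(2) g(1) by (simp add: lead_coeff_mult del: mult_pCons_left)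
  moreover have "poly g c = 0 \<Longrightarrow> cmod c \<le> 1" for c using Suc.prems(3)[of c] g(1) by simp
  ultimately obtain a where a: "g = (\<Prod>j=1..n. [:- a j, 1:])" "\<forall>j\<in>{1..n}. cmod (a j) \<le> 1"
    using Suc.IH[OF g(2)] by (auto simp: monic_disc_polys_def)
  let ?a = "a(Suc n := b)"
  have "(\<Prod>j=1..Suc n. [:- ?a j, 1:]) = (\<Prod>j=1..n. [:- ?a j, 1:]) * [:-b, 1:]" by simp
  also have "(\<Prod>j=1..n. [:- ?a j, 1:]) = g" unfolding a(1) by (rule prod.cong) auto
  finally have "f = (\<Prod>j=1..Suc n. [:- ?a j, 1:])" using g(1) by (simp add: mult.commute)
  moreover have "\<forall>j\<in>{1..Suc n}. cmod (?a j) \<le> 1" using a(2) Suc.prems(3)[OF g(3)] by auto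
  ultimately show ?case unfolding monic_disc_polys_def by blast
qed

text \<open>The sign of the right-hand side decides which of the two moduli is larger, according to
  the position of \<open>z\<close> and \<open>a\<close> relative to the unit circle.\<close>

lemma disc_factor_identity:
  fixes a z :: complex
  shows "(cmod (1 - cnj a * z))\<^sup>2 - (cmod (z - a))\<^sup>2 = (1 - (cmod z)\<^sup>2) * (1 - (cmod a)\<^sup>2)"
proof -
  have "(1 - (p * x + q * y))\<^sup>2 + (p * y - q * x)\<^sup>2 - ((x - p)\<^sup>2 + (y - q)\<^sup>2) =
      (1 - (x\<^sup>2 + y\<^sup>2)) * (1 - (p\<^sup>2 + q\<^sup>2))" for p q x y :: real
    by algebra
  from this[of "Re a" "Re z" "Im a" "Im z"] show ?thesis
    unfolding cmod_power2 by (simp add: power2_commute[of "Im a * Re z"])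
qed

text \<open>\<open>cmod z ^ degree Q * cmod (poly Q (1 / cnj z))\<close> is the modulus at
  \<open>z\<close> of the reciprocal polynomial of \<open>Q\<close>, in which
  \<open>1 - cnj b * z\<close> replaces each factor \<open>z - b\<close>. The factors are compared
  one by one with \<open>disc_factor_identity\<close>.\<close>

lemma reciprocal_poly_bounds:
  fixes Q :: "complex poly"
  assumes "\<And>b. poly Q b = 0 \<Longrightarrow> 1 \<le> cmod b" "z \<noteq> 0"
  shows "1 \<le> cmod z \<Longrightarrow> cmod (poly Q z) \<le> cmod z ^ degree Q * cmod (poly Q (1 / cnj z))"
    and "cmod z \<le> 1 \<Longrightarrow> cmod z ^ degree Q * cmod (poly Q (1 / cnj z)) \<le> cmod (poly Q z)"
proof -
  define d where "d = degree Q"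
  have "(1 \<le> cmod z \<longrightarrow> cmod (poly Q z) \<le> cmod z ^ d * cmod (poly Q (1 / cnj z))) \<and>
      (cmod z \<le> 1 \<longrightarrow> cmod z ^ d * cmod (poly Q (1 / cnj z)) \<le> cmod (poly Q z))"
    using assms(1) d_def[symmetric]
  proof (induction d arbitrary: Q)
    case 0
    then obtain c where "Q = [:c:]" by (metis degree_eq_zeroE)
    then show ?case by simp
  next
    case (Suc d)
    obtain b g where g: "Q = [:-b, 1:] * g" "degree g = d" "poly Q b = 0"
      using root_factor[OF Suc.prems(2)] .
    have b: "1 \<le> cmod b" using Suc.prems(1) g(3) .
    have rt: "poly g c = 0 \<Longrightarrow> 1 \<le> cmod c" for c using Suc.prems(1)[of c] g(1) by simp
    note IH = Suc.IH[OF rt g(2)]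
    have z: "cmod z * cmod (1 / cnj z - b) = cmod (1 - cnj b * z)"
    proof -
      have "cmod z * cmod (1 / cnj z - b) = cmod (cnj z * (1 / cnj z - b))" by (simp add: norm_mult)
      also have "cnj z * (1 / cnj z - b) = cnj (1 - cnj b * z)" using assms(2) by (simp add: field_simps)
      finally show ?thesis by (simp only: complex_mod_cnj)
    qed
    have e: "poly Q x = (x - b) * poly g x" for x unfolding g(1) by (simp add: algebra_simps)
    have L: "cmod z ^ Suc d * cmod (poly Q (1 / cnj z)) = cmod (1 - cnj b * z) * (cmod z ^ d * cmod (poly g (1 / cnj z)))"
      unfolding e norm_mult z[symmetric] by simp
    have b2: "1 - (cmod b)\<^sup>2 \<le> 0" using power_mono[OF b, of 2] by simp
    show ?case unfolding L unfolding e norm_mult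
    proof (intro conjI impI)
      assume z1: "1 \<le> cmod z"
      have "1 - (cmod z)\<^sup>2 \<le> 0" using power_mono[OF z1, of 2] by simp
      then have "(cmod (z - b))\<^sup>2 \<le> (cmod (1 - cnj b * z))\<^sup>2"
        using disc_factor_identity[of b z] mult_nonpos_nonpos[OF _ b2, of "1 - (cmod z)\<^sup>2"] by linarith
      then have "cmod (z - b) \<le> cmod (1 - cnj b * z)" by (rule power2_le_imp_le) simp
      then show "cmod (z - b) * cmod (poly g z) \<le> cmod (1 - cnj b * z) * (cmod z ^ d * cmod (poly g (1 / cnj z)))"
        using IH z1 by (intro mult_mono) auto
    next
      assume z1: "cmod z \<le> 1"
      then have "0 \<le> 1 - (cmod z)\<^sup>2" by (simp add: power_le_one)
      then have "(cmod (1 - cnj b * z))\<^sup>2 \<le> (cmod (z - b))\<^sup>2"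
        using disc_factor_identity[of b z] mult_nonneg_nonpos[OF _ b2, of "1 - (cmod z)\<^sup>2"] by linarith
      then have "cmod (1 - cnj b * z) \<le> cmod (z - b)" by (rule power2_le_imp_le) simp
      then show "cmod (1 - cnj b * z) * (cmod z ^ d * cmod (poly g (1 / cnj z))) \<le> cmod (z - b) * cmod (poly g z)"
        using IH z1 by (intro mult_mono) auto
    qed
  qed
  then show "1 \<le> cmod z \<Longrightarrow> cmod (poly Q z) \<le> cmod z ^ degree Q * cmod (poly Q (1 / cnj z))"
    and "cmod z \<le> 1 \<Longrightarrow> cmod z ^ degree Q * cmod (poly Q (1 / cnj z)) \<le> cmod (poly Q z)"
    by (simp_all add: d_def)
qed

text \<open>Outside the closed disc the term \<open>z^(n - d) * R\<close> exceeds \<open>Q\<close>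
  in modulus, which excludes zeros there. On \<open>W\<close> the power \<open>z^(n - d)\<close>
  makes that term too small to undo the gain of \<open>Q\<close> over \<open>1\<close>.\<close>

lemma monic_disc_poly_large_on:
  assumes G: "degree G \<le> D" "poly G 0 = 0" "\<And>z. z \<in> W \<Longrightarrow> cmod (poly G z - 1) \<le> 1/2"
      "\<And>z. z \<in> cball 0 1 \<Longrightarrow> cmod (poly G z) \<le> B"
    and W: "W \<subseteq> cball 0 (1/2)" "0 \<notin> W"
    and B: "1 \<le> B" and n: "D < n" "(1/2)^(n - D) \<le> 1 / (16 * B)"
  obtains f where "f \<in> monic_disc_polys n" "\<And>z. z \<in> W \<Longrightarrow> 1 < cmod (poly f z)"
proof
  \<comment> \<open>With this choice \<open>e * cmod (poly G z) \<le> 1/2\<close> on the closed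
    disc, so \<open>Q\<close> has no zeros there.\<close>
  define e where "e = 1 / (2 * B)"
  have e: "0 < e" "e \<le> 1/2" using B by (auto simp: e_def field_simps)
  define Q where "Q = 1 + smult (of_real e) G"
  have Qz: "poly Q z = 1 + of_real e * poly G z" for z by (simp add: Q_def)
  define d where "d = degree Q"
  have d: "d \<le> D" unfolding d_def Q_def using G(1) by (intro degree_add_le) auto
  have nz: "poly Q z \<noteq> 0" if "cmod z \<le> 1" for z
  proof
    assume "poly Q z = 0"
    then have "of_real e * poly G z = -1" unfolding Qz by (simp add: eq_neg_iff_add_eq_0 add.commute)
    then have "e * cmod (poly G z) = 1" using e by (metis norm_minus_cancel norm_mult norm_of_real norm_one abs_of_pos)
    moreover have "e * cmod (poly G z) \<le> e * B" using G(4)[of z] that e by (intro mult_left_mono) auto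
    moreover have "e * B = 1/2" using B by (simp add: e_def)
    ultimately show False by linarith
  qed
  have rt: "1 \<le> cmod b" if "poly Q b = 0" for b using nz[of b] that by linarith
  define R where "R = reflect_poly (map_poly cnj Q)"
  \<comment> \<open>The constant coefficient \<open>1\<close>, due to \<open>poly G 0 = 0\<close>,
    becomes the leading coefficient of \<open>R\<close>: it gives \<open>R\<close> the full degree
    \<open>d\<close> and makes \<open>f\<close> monic.\<close>
  have Q0: "coeff Q 0 = 1" using Qz[of 0] G(2) by (simp add: poly_0_coeff_0)
  have degc: "degree (map_poly cnj Q) = d" unfolding d_def by (rule degree_map_poly) auto
  have c0: "coeff (map_poly cnj Q) 0 = 1" using Q0 by (simp add: coeff_map_poly)
  have degR: "degree R = d" unfolding R_def using c0 degc by (simp add: degree_reflect_poly_eq)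
  have leadR: "coeff R d = 1" unfolding R_def using c0 degc by (simp add: coeff_reflect_poly)
  have Rz: "cmod (poly R z) = cmod z ^ d * cmod (poly Q (1 / cnj z))" if "z \<noteq> 0" for z
  proof -
    have "poly R z = z^d * poly (map_poly cnj Q) (inverse z)" unfolding R_def
      using poly_reflect_poly_nz[OF that, of "map_poly cnj Q"] degc by simp
    also have "poly (map_poly cnj Q) (inverse z) = cnj (poly Q (1 / cnj z))"
      unfolding poly_cnj by (simp add: inverse_eq_divide)
    finally show ?thesis by (simp only: norm_mult norm_power complex_mod_cnj)
  qed
  have dn: "d < n" using d n by simp
  define f where "f = Q + monom 1 (n - d) * R"
  have fz: "poly f z = poly Q z + z^(n - d) * poly R z" for z by (simp add: f_def poly_monom)
  have "R \<noteq> 0" using leadR by auto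
  then have deg2: "degree (monom 1 (n - d) * R) = n"
    using degR dn by (simp add: degree_mult_eq degree_monom_eq)
  have degf: "degree f = n" unfolding f_def using deg2 dn d_def by (simp add: degree_add_eq_right)
  have "coeff f n = coeff (monom 1 (n - d) * R) n" unfolding f_def using dn d_def by (simp add: coeff_eq_0)
  also have "\<dots> = 1" using leadR dn by (simp add: coeff_monom_mult)
  finally have lead: "lead_coeff f = 1" using degf by simp
  show "f \<in> monic_disc_polys n"
  proof (rule monic_disc_polysI[OF degf lead], rule ccontr)
    fix b assume b: "poly f b = 0" "\<not> cmod b \<le> 1"
    then have b0: "b \<noteq> 0" and b1: "1 < cmod b" by auto
    have "poly Q b = - (b^(n - d) * poly R b)" using b fz by (simp add: eq_neg_iff_add_eq_0)
    then have "cmod (poly Q b) = cmod b^(n - d) * (cmod b ^ d * cmod (poly Q (1 / cnj b)))"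
      by (simp add: norm_mult norm_power Rz b0)
    then have eq: "cmod (poly Q b) = cmod b^n * cmod (poly Q (1 / cnj b))"
      using dn by (simp add: power_add[symmetric] mult.assoc[symmetric])
    have "poly Q (1 / cnj b) \<noteq> 0" by (rule nz) (use b1 in \<open>simp add: norm_divide divide_le_eq_1\<close>)
    then have "cmod b^d * cmod (poly Q (1 / cnj b)) < cmod b^n * cmod (poly Q (1 / cnj b))"
      by (intro mult_strict_right_mono power_strict_increasing[OF dn b1]) simp
    moreover have "cmod (poly Q b) \<le> cmod b^d * cmod (poly Q (1 / cnj b))"
      unfolding d_def by (rule reciprocal_poly_bounds(1)[OF rt b0]) (use b1 in auto)
    ultimately show False unfolding eq by linarith
  qed
  show "1 < cmod (poly f z)" if z: "z \<in> W" for z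
  proof -
    have z0: "z \<noteq> 0" and z1: "cmod z \<le> 1/2" using z W by auto
    have "cmod (poly R z) \<le> cmod (poly Q z)"
      unfolding Rz[OF z0] d_def by (rule reciprocal_poly_bounds(2)[OF rt z0]) (use z1 in auto)
    \<comment> \<open>\<open>e/8\<close> equals \<open>1 / (16 * B)\<close>, the bound assumed for
      \<open>(1/2)^(n - D)\<close>. The resulting loss factor \<open>1 - e/8\<close> is outweighed
      by the gain \<open>1 + e/2\<close>.\<close>
    moreover have "cmod z^(n - d) \<le> e/8"
    proof -
      have "cmod z^(n - d) \<le> (1/2)^(n - d)" using z1 by (intro power_mono) auto
      also have "\<dots> \<le> (1/2)^(n - D)" using d n by (intro power_decreasing) auto
      finally show ?thesis using n(2) by (simp add: e_def)
    qed
    ultimately have 1: "cmod (z^(n - d) * poly R z) \<le> e/8 * cmod (poly Q z)"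
      unfolding norm_mult norm_power using e by (intro mult_mono) auto
    have "\<bar>Re (poly G z - 1)\<bar> \<le> 1/2" using G(3)[OF z] abs_Re_le_cmod order_trans by blast
    then have "1/2 \<le> Re (poly G z)" unfolding minus_complex.sel one_complex.sel by linarith
    then have "e * (1/2) \<le> e * Re (poly G z)" by (rule mult_left_mono[OF _ less_imp_le[OF e(1)]])
    moreover have "Re (poly Q z) = 1 + e * Re (poly G z)" unfolding Qz by simp
    ultimately have 2: "1 + e/2 \<le> cmod (poly Q z)" using complex_Re_le_cmod[of "poly Q z"] by linarith
    have "cmod (poly Q z) - cmod (z^(n - d) * poly R z) \<le> cmod (poly f z)"
      unfolding fz by (metis norm_diff_ineq)
    moreover have "cmod (poly Q z) * (1 - e/8) = cmod (poly Q z) - e/8 * cmod (poly Q z)" by (simp add: algebra_simps)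
    ultimately have 3: "cmod (poly Q z) * (1 - e/8) \<le> cmod (poly f z)" using 1 by linarith
    have 4: "(1 + e/2) * (1 - e/8) \<le> cmod (poly Q z) * (1 - e/8)"
      by (rule mult_right_mono[OF 2]) (use e in linarith)
    have "e * e \<le> e * (1/2)" by (rule mult_left_mono[OF e(2) less_imp_le[OF e(1)]])
    moreover have "(1 + e/2) * (1 - e/8) = 1 + 3/8 * e - (e * e) / 16" by (simp add: field_simps)
    ultimately have "1 < (1 + e/2) * (1 - e/8)" using e(1) by linarith
    with 3 4 show ?thesis by linarith
  qed
qed

section \<open>The upper bound\<close>

text \<open>Let \<open>c * z^k\<close> be the first nonzero term of \<open>F\<close> after the
  constant \<open>1\<close>. The direction \<open>e\<close> turns it into
  \<open>- cmod c * t^k\<close>, and for small \<open>t\<close> the remaining terms are smaller than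
  this.\<close>

lemma descent_direction:
  fixes F :: "complex poly"
  assumes deg: "0 < degree F" and F0: "poly F 0 = 1"
  obtains e s where "cmod e = 1" "0 < s" "\<And>t. 0 < t \<Longrightarrow> t \<le> s \<Longrightarrow> cmod (poly F (of_real t * e)) < 1"
proof -
  define p where "p = F - 1"
  define k where "k = order 0 p"
  have "p \<noteq> 0" using deg by (auto simp: p_def)
  moreover have "poly p 0 = 0" by (simp add: p_def F0)
  ultimately have k: "0 < k" by (metis k_def gr0I order_root)
  obtain q where q: "p = [:-0, 1:]^k * q" "\<not> [:-0, 1:] dvd q"
    using order_decomp[OF \<open>p \<noteq> 0\<close>, of 0] unfolding k_def by blast
  define c where "c = poly q 0"
  have c: "c \<noteq> 0" using q(2) by (simp only: c_def poly_eq_0_iff_dvd not_False_eq_True)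
  have Fz: "poly F z = 1 + z^k * poly q z" for z
  proof -
    have "poly p z = z^k * poly q z" by (subst q(1)) simp
    then show ?thesis by (simp add: p_def algebra_simps)
  qed
  define e where "e = cis ((pi - Arg c) / real k)"
  have e1: "e^k = cis (pi - Arg c)" unfolding e_def Complex.DeMoivre using k by simp
  have c1: "of_real (cmod c) * cis (Arg c) = c" using rcis_cmod_Arg[of c] by (simp only: rcis_def)
  have "e^k * c = cis (pi - Arg c) * (of_real (cmod c) * cis (Arg c))" by (simp only: e1 c1)
  also have "\<dots> = of_real (cmod c) * (cis (pi - Arg c) * cis (Arg c))" by (simp only: mult_ac)
  also have "\<dots> = - of_real (cmod c)" by (simp add: cis_mult)
  finally have ec: "e^k * c = - of_real (cmod c)" .
  have "isCont (poly q) 0" by simp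
  moreover have "0 < cmod c" using c by simp
  ultimately obtain s1 where "0 < s1" "\<forall>z. dist z 0 < s1 \<longrightarrow> dist (poly q z) (poly q 0) < cmod c"
    unfolding continuous_at_eps_delta by blast
  then have s1: "0 < s1" "\<And>z. cmod z < s1 \<Longrightarrow> cmod (poly q z - c) < cmod c"
    by (simp_all add: dist_norm c_def)
  \<comment> \<open>The three bounds keep the point where \<open>poly q\<close> is close to
    \<open>c\<close>, ensure \<open>t^k \<le> t\<close>, and ensure
    \<open>t * cmod c \<le> 1\<close>.\<close>
  define s where "s = min (s1 / 2) (min 1 (1 / cmod c))"
  have "cmod (poly F (of_real t * e)) < 1" if t: "0 < t" "t \<le> s" for t
  proof -
    let ?z = "of_real t * e"
    have z: "cmod ?z = t" using t by (simp add: e_def norm_mult)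
    have "t^k \<le> t" using power_decreasing[of 1 k t] k t by (simp add: s_def)
    also have "t \<le> 1 / cmod c" using t by (simp add: s_def)
    finally have tk: "t^k * cmod c \<le> 1" using c by (simp add: field_simps)
    have "poly F ?z = (1 - of_real (t^k * cmod c)) + of_real (t^k) * (e^k * (poly q ?z - c))"
      unfolding Fz right_diff_distrib ec by (simp add: power_mult_distrib algebra_simps)
    also have "cmod \<dots> \<le> cmod (1 - of_real (t^k * cmod c)) + cmod (of_real (t^k) * (e^k * (poly q ?z - c)))"
      by (rule norm_triangle_ineq)
    also have "cmod (1 - of_real (t^k * cmod c)) = 1 - t^k * cmod c"
      using tk by (metis abs_of_nonneg diff_ge_0_iff_ge norm_of_real of_real_1 of_real_diff)
    also have "cmod (of_real (t^k) * (e^k * (poly q ?z - c))) = t^k * cmod (poly q ?z - c)"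
      using t by (simp add: e_def norm_mult norm_power)
    also have "\<dots> < t^k * cmod c"
      using t s1 z by (intro mult_strict_left_mono s1(2)) (auto simp: s_def)
    finally show ?thesis by simp
  qed
  moreover have "0 < s" using s1(1) c by (simp add: s_def)
  moreover have "cmod e = 1" by (simp add: e_def)
  ultimately show ?thesis using that by blast
qed

text \<open>The closed disc minus the balls of radius \<open>d\<close> about the roots is compact.
  If it is nonempty, \<open>cmod (poly F z)\<close> has a positive minimum on it, and half of that
  serves as \<open>h\<close>.\<close>

lemma small_value_near_root:
  fixes F :: "complex poly"
  assumes "0 < d"
  obtains h where "0 < h" "\<And>z. cmod z \<le> 1 \<Longrightarrow> cmod (poly F z) \<le> h \<Longrightarrow> \<exists>b. poly F b = 0 \<and> cmod (z - b) < d"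
proof -
  define K where "K = cball 0 1 - (\<Union>b\<in>{b. poly F b = 0}. ball b d)"
  have K: "compact K" unfolding K_def by (intro compact_diff compact_cball open_UN ballI open_ball)
  have out: "z \<in> K \<or> (\<exists>b. poly F b = 0 \<and> cmod (z - b) < d)" if "cmod z \<le> 1" for z
    using that by (auto simp: K_def dist_norm norm_minus_commute)
  show ?thesis
  proof (cases "K = {}")
    case True
    then show ?thesis using out that[of 1] by auto
  next
    case False
    have "continuous_on K (\<lambda>z. cmod (poly F z))" by (intro continuous_intros)
    then obtain x where x: "x \<in> K" "\<And>y. y \<in> K \<Longrightarrow> cmod (poly F x) \<le> cmod (poly F y)"
      using continuous_attains_inf[OF K False, of "\<lambda>z. cmod (poly F z)"] by blast
    have "poly F x \<noteq> 0" using x(1) assms by (auto simp: K_def)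
    then have "0 < cmod (poly F x) / 2" by simp
    then show ?thesis
      by (rule that) (use out x(2) \<open>poly F x \<noteq> 0\<close> in \<open>fastforce dest: order_trans\<close>)
  qed
qed

section \<open>Curves of bounded length inside a set\<close>

definition connects :: "complex set \<Rightarrow> complex \<Rightarrow> complex \<Rightarrow> real \<Rightarrow> bool" where
  "connects E z w L \<longleftrightarrow> (\<exists>g. path g \<and> path_image g \<subseteq> E \<and> pathstart g = z \<and> pathfinish g = w \<and>
     length_le g {0..1} L)"

lemma connects_join:
  assumes "connects E x y L1" "connects E y z L2"
  shows "connects E x z (L1 + L2)"
proof -
  obtain g h where g: "path g" "path_image g \<subseteq> E" "pathstart g = x" "pathfinish g = y" "length_le g {0..1} L1"
    and h: "path h" "path_image h \<subseteq> E" "pathstart h = y" "pathfinish h = z" "length_le h {0..1} L2"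
    using assms unfolding connects_def by blast
  have "length_le (g +++ h) {0..1/2} L1"
    by (rule length_le_reparam[OF g(5), of _ "\<lambda>t. 2 * t"]) (auto simp: mono_on_def joinpaths_def)
  moreover have "length_le (g +++ h) {1/2..1} L2"
  proof (rule length_le_reparam[OF h(5), of _ "\<lambda>t. 2 * t - 1"])
    fix t :: real assume "t \<in> {1/2..1}"
    then show "(g +++ h) t = h (2 * t - 1)"
    proof (cases "t = 1/2")
      case True
      show ?thesis unfolding True using g(4) h(3) by (simp add: joinpaths_def pathfinish_def pathstart_def)
    qed (simp add: joinpaths_def)
  qed (auto simp: mono_on_def)
  ultimately have "length_le (g +++ h) {0..1} (L1 + L2)" by (rule length_le_join) auto
  then show ?thesis unfolding connects_def using g h
    by (intro exI[of _ "g +++ h"]) (auto simp: path_image_join)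
qed

lemma connects_restrict:
  assumes g: "continuous_on {0..\<tau>} g" "length_le g {0..\<tau>} L" "g ` {0..\<tau>} \<subseteq> E" and \<tau>: "0 \<le> \<tau>"
  shows "connects E (g 0) (g \<tau>) L"
proof -
  let ?h = "\<lambda>t. g (\<tau> * t)"
  have im: "\<tau> * t \<in> {0..\<tau>}" if "t \<in> {0..1}" for t using that \<tau> by (auto intro: mult_left_le)
  have "path ?h" unfolding path_def
    by (rule continuous_on_compose2[OF g(1)]) (use im in \<open>auto intro!: continuous_intros\<close>)
  moreover have "path_image ?h \<subseteq> E" using g(3) im by (force simp: path_image_def)
  moreover have "length_le ?h {0..1} L"
    by (rule length_le_reparam[OF g(2), of _ "\<lambda>t. \<tau> * t"]) (use im \<tau> in \<open>auto simp: mono_on_def mult_left_mono\<close>)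
  ultimately show ?thesis unfolding connects_def
    by (intro exI[of _ ?h]) (simp add: pathstart_def pathfinish_def)
qed

text \<open>\<open>\<tau>\<close> is the first time of modulus at least \<open>1\<close>; the
  intermediate value theorem forces equality there.\<close>

lemma first_exit:
  fixes g :: "real \<Rightarrow> complex"
  assumes cont: "continuous_on {0..1} g" and g0: "cmod (g 0) \<le> 1" and s: "s \<in> {0..1}" "1 \<le> cmod (g s)"
  obtains \<tau> where "\<tau> \<in> {0..1}" "cmod (g \<tau>) = 1" "\<And>t. t \<in> {0..\<tau>} \<Longrightarrow> cmod (g t) \<le> 1"
proof -
  have nc: "continuous_on {0..1} (\<lambda>t. cmod (g t))" using cont by (intro continuous_intros)
  define A where "A = {t \<in> {0..1}. 1 \<le> cmod (g t)}"
  have "A = {0..1} \<inter> (\<lambda>t. cmod (g t)) -` {1..}" by (auto simp: A_def)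
  then have "closed A" using continuous_closed_preimage[OF nc closed_real_atLeastAtMost, of "{1..}"] by simp
  moreover have "bounded A" by (rule bounded_subset[OF bounded_closed_interval[of 0 1]]) (auto simp: A_def)
  ultimately have A: "compact A" by (simp add: compact_eq_bounded_closed)
  have "A \<noteq> {}" using s by (auto simp: A_def)
  from compact_attains_inf[OF A this]
  obtain \<tau> where \<tau>: "\<tau> \<in> A" "\<And>t. t \<in> A \<Longrightarrow> \<tau> \<le> t" by blast
  have "\<exists>t. 0 \<le> t \<and> t \<le> \<tau> \<and> cmod (g t) = 1"
    by (rule IVT'[of "\<lambda>t. cmod (g t)", OF g0]) (use \<tau>(1) in \<open>auto simp: A_def intro: continuous_on_subset[OF nc]\<close>)
  then obtain t where t: "0 \<le> t" "t \<le> \<tau>" "cmod (g t) = 1" by blast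
  then have "t \<in> A" using \<tau>(1) by (auto simp: A_def)
  then have "cmod (g \<tau>) = 1" using \<tau>(2)[of t] t by simp
  moreover have "cmod (g r) \<le> 1" if "r \<in> {0..\<tau>}" for r
  proof (cases "r = \<tau>")
    case False
    then have "r \<notin> A" using that \<tau>(2)[of r] by auto
    then show ?thesis using that \<tau>(1) by (auto simp: A_def)
  qed (use \<open>cmod (g \<tau>) = 1\<close> in simp)
  ultimately show ?thesis using that \<tau>(1) by (auto simp: A_def)
qed

lemma length_le_mono:
  assumes "length_le g T L" "S \<subseteq> T" "L \<le> L'"
  shows "length_le g S L'"
  using assms unfolding length_le_def by (meson order_trans)

lemma connects_mono:
  assumes "connects E z w L" "L \<le> L'"
  shows "connects E z w L'"
  using assms length_le_mono[OF _ order_refl assms(2)] unfolding connects_def by blast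

lemma connects_segment:
  assumes "closed_segment z w \<subseteq> E"
  shows "connects E z w (dist z w)"
  unfolding connects_def using assms length_le_linepath[of z w]
  by (intro exI[of _ "linepath z w"]) auto

text \<open>The path consists of a radial segment shorter than \<open>\<epsilon>/2\<close> after
  which \<open>F\<close> has modulus below \<open>1\<close>, a lifted segment of length at most
  \<open>pi * n\<close> and, if the lift stays in the open disc, a closing piece of length at most
  \<open>\<epsilon>/2\<close>.\<close>

lemma short_exit_path:
  fixes F :: "complex poly"
  assumes n: "degree F \<le> n" "1 \<le> n" and F0: "poly F 0 = 1"
    and roots: "\<And>b. poly F b = 0 \<Longrightarrow> 1 \<le> cmod b" and eps: "0 < \<epsilon>"
  shows "\<exists>\<zeta>. cmod \<zeta> = 1 \<and> connects {z. cmod z \<le> 1 \<and> cmod (poly F z) \<le> 1} 0 \<zeta> (pi * real n + \<epsilon>)"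
proof (cases "degree F = 0")
  case True
  let ?E = "{z. cmod z \<le> 1 \<and> cmod (poly F z) \<le> 1}"
  obtain c where "F = [:c:]" using degree_eq_zeroE[OF True] .
  then have F: "poly F z = 1" for z using F0 by simp
  have "closed_segment 0 1 \<subseteq> cball (0::complex) 1" by (rule closed_segment_subset) auto
  then have "closed_segment 0 1 \<subseteq> ?E" by (auto simp: F)
  then have "connects ?E 0 1 (dist 0 (1::complex))" by (rule connects_segment)
  moreover have "1 \<le> pi * real n"
    using mult_mono[of 1 pi 1 "real n"] pi_gt3 n(2) by simp
  then have "dist 0 (1::complex) \<le> pi * real n + \<epsilon>" using eps by simp
  ultimately have "connects ?E 0 1 (pi * real n + \<epsilon>)" by (rule connects_mono)
  then show ?thesis by (intro exI[of _ 1]) simp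
next
  case False
  then have deg: "0 < degree F" by simp
  let ?E = "{z. cmod z \<le> 1 \<and> cmod (poly F z) \<le> 1}"
  define crit where "crit = poly F ` {z. poly (pderiv F) z = 0}"
  have "pderiv F \<noteq> 0" using deg by (simp add: pderiv_eq_0_iff)
  then have fcrit: "finite crit" unfolding crit_def by (intro finite_imageI poly_roots_finite)
  obtain e s where e: "cmod e = 1" and s: "0 < s" "\<And>t. 0 < t \<Longrightarrow> t \<le> s \<Longrightarrow> cmod (poly F (of_real t * e)) < 1"
    using descent_direction[OF deg F0] by blast
  have e0: "e \<noteq> 0" using e by auto
  \<comment> \<open>Finitely many parameters are to be avoided so that the lift starts at a
    noncritical value \<open>w0\<close>.\<close>
  define bad where "bad = {t::real. poly F (of_real t * e) \<in> crit}"
  have "finite bad"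
  proof -
    have "finite {z. poly F z = c}" for c
    proof -
      have "F - [:c:] \<noteq> 0" using deg by auto
      then have "finite {z. poly (F - [:c:]) z = 0}" by (rule poly_roots_finite)
      then show ?thesis by simp
    qed
    then have "finite (\<Union>c\<in>crit. {z. poly F z = c})" using fcrit by blast
    moreover have "(\<lambda>t. of_real t * e) ` bad \<subseteq> (\<Union>c\<in>crit. {z. poly F z = c})" by (auto simp: bad_def)
    ultimately have "finite ((\<lambda>t. of_real t * e) ` bad)" using finite_subset by blast
    moreover have "inj_on (\<lambda>t. complex_of_real t * e) bad" using e0 by (auto simp: inj_on_def)
    ultimately show ?thesis by (rule finite_imageD)
  qed
  moreover have "infinite {0<..<min s (min (\<epsilon>/2) 1)}" using s(1) eps by (intro infinite_Ioo) auto
  ultimately obtain t where t: "t \<in> {0<..<min s (min (\<epsilon>/2) 1)}" "t \<notin> bad"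
    by (meson finite_subset subsetI)
  then have t0: "0 < t" "t < s" "t < \<epsilon>/2" "t < 1" by auto
  define z0 where "z0 = of_real t * e"
  define w0 where "w0 = poly F z0"
  have z0: "cmod z0 = t" "cmod z0 < 1" using t(1) e by (auto simp: z0_def norm_mult)
  have w0: "w0 \<noteq> 0" "cmod w0 < 1" "w0 \<notin> crit"
    using roots[of z0] z0 s(2)[of t] t by (auto simp: w0_def z0_def bad_def)
  have start: "connects ?E 0 z0 t"
  proof -
    have "u \<in> ?E" if u: "u \<in> closed_segment 0 z0" for u
    proof -
      obtain r where "0 \<le> r" "r \<le> 1" "u = of_real (r * t) * e"
        using u by (auto simp: in_segment z0_def scaleR_conv_of_real mult.assoc)
      moreover from this have "r * t \<le> t" "0 \<le> r * t" using t(1) by (auto intro: mult_left_le_one_le)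
      ultimately have rt: "0 \<le> r * t" "r * t \<le> t" "u = of_real (r * t) * e" by auto
      have "cmod u = r * t" by (simp only: rt(3) norm_mult norm_of_real e abs_of_nonneg[OF rt(1)] mult_1_right)
      then have "cmod u \<le> 1" using rt(2) t0 by linarith
      moreover have "cmod (poly F u) \<le> 1"
      proof (cases "r * t = 0")
        case True
        then show ?thesis unfolding rt(3) by (simp only: of_real_0 mult_zero_left F0 norm_one order_refl)
      next
        case False
        then have "0 < r * t" "r * t \<le> s" using rt t0 by linarith+
        then have "cmod (poly F u) < 1" unfolding rt(3) by (rule s(2))
        then show ?thesis by simp
      qed
      ultimately show ?thesis by simp
    qed
    then have "connects ?E 0 z0 (dist 0 z0)" by (intro connects_segment) blast
    then show ?thesis using z0 by simp
  qed
  obtain d1 where d1: "0 < d1" "\<And>x y. x \<in> cball 0 3 \<Longrightarrow> y \<in> cball 0 3 \<Longrightarrow> dist x y < d1 \<Longrightarrow> dist (poly F x) (poly F y) < 1"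
  proof -
    have "uniformly_continuous_on (cball 0 3) (poly F)"
      by (rule compact_uniformly_continuous) (auto intro!: continuous_intros)
    from uniformly_continuous_onE[OF this zero_less_one]
    obtain d1 where "0 < d1"
      "\<And>x y. x \<in> cball 0 3 \<Longrightarrow> y \<in> cball 0 3 \<Longrightarrow> dist y x < d1 \<Longrightarrow> dist (poly F y) (poly F x) < 1"
      by metis
    then show ?thesis by (intro that) auto
  qed
  \<comment> \<open>For the closing segment: \<open>d1\<close> keeps \<open>poly F\<close> within
    \<open>1\<close> of its value \<open>0\<close> at the root, \<open>1\<close> keeps the segment
    in \<open>cball 0 3\<close>, where \<open>d1\<close> applies, and \<open>\<epsilon>/2\<close>
    bounds its length.\<close>
  define d where "d = min d1 (min 1 (\<epsilon>/2))"
  have "0 < d" using d1 eps by (simp add: d_def)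
  then obtain h where h: "0 < h" "\<And>z. cmod z \<le> 1 \<Longrightarrow> cmod (poly F z) \<le> h \<Longrightarrow> \<exists>b. poly F b = 0 \<and> cmod (z - b) < d"
    using small_value_near_root by blast
  \<comment> \<open>The segment is aimed at \<open>\<i> * \<sigma> * w0\<close> instead of
    \<open>0\<close>, as \<open>0\<close> may be a critical value and others may lie on the way. A
    critical value other than \<open>w0\<close> can lie on the segment only if
    \<open>\<sigma>\<close> is the quotient below, which leaves infinitely many choices.\<close>
  have "infinite {0<..<min h 1}" using h(1) by (intro infinite_Ioo) auto
  moreover have "finite ((\<lambda>c. Im (c/w0) / (1 - Re (c/w0))) ` crit)" using fcrit by (rule finite_imageI)
  ultimately obtain \<sigma> where \<sigma>: "\<sigma> \<in> {0<..<min h 1}" "\<sigma> \<notin> (\<lambda>c. Im (c/w0) / (1 - Re (c/w0))) ` crit"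
    by (meson finite_subset subsetI)
  define w where "w = w0 * (\<i> * of_real \<sigma> - 1)"
  have "\<i> * of_real \<sigma> - 1 \<noteq> 0" by (simp add: complex_eq_iff)
  then have w: "w \<noteq> 0" using w0(1) by (simp add: w_def)
  have line: "w0 + of_real r * w = w0 * (of_real (1 - r) + \<i> * of_real (r * \<sigma>))" for r
    by (simp add: w_def algebra_simps)
  have noncrit: "poly (pderiv F) z \<noteq> 0" if "poly F z = w0 + of_real r * w" for r z
  proof
    assume "poly (pderiv F) z = 0"
    then have c: "poly F z \<in> crit" by (auto simp: crit_def)
    have q: "poly F z / w0 = of_real (1 - r) + \<i> * of_real (r * \<sigma>)" unfolding that line using w0(1) by simp
    \<comment> \<open>The denominator \<open>1 - Re (poly F z / w0)\<close> equals \<open>r\<close>;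
      it is nonzero because \<open>r = 0\<close> would give the noncritical value
      \<open>w0\<close>.\<close>
    have "r \<noteq> 0" using c w0(3) that by auto
    then have "\<sigma> = Im (poly F z / w0) / (1 - Re (poly F z / w0))" unfolding q by simp
    then show False using \<sigma>(2) c by blast
  qed
  obtain g where g: "continuous_on {0..1} g" "g 0 = z0" "\<And>r. r \<in> {0..1} \<Longrightarrow> poly F (g r) = w0 + of_real r * w"
    by (rule lift_segment[OF deg, of z0 w0 w]) (use noncrit w0_def in auto)
  \<comment> \<open>Both ends of the segment have modulus below \<open>1\<close>, so the lift stays
    where \<open>cmod (poly F z) \<le> 1\<close>.\<close>
  have small: "cmod (poly F (g r)) \<le> 1" if r: "r \<in> {0..1}" for r
  proof -
    have "cmod (of_real (1 - r) + \<i> * of_real (r * \<sigma>)) \<le> (1 - r) + r * \<sigma>"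
    proof (rule order_trans[OF norm_triangle_ineq])
      have "cmod (of_real (1 - r)) = 1 - r" using r by (simp only: norm_of_real) simp
      moreover have "cmod (\<i> * of_real (r * \<sigma>)) = r * \<sigma>"
        using r \<sigma>(1) by (simp only: norm_mult norm_of_real norm_ii) simp
      ultimately show "cmod (of_real (1 - r)) + cmod (\<i> * of_real (r * \<sigma>)) \<le> (1 - r) + r * \<sigma>" by simp
    qed
    also have "\<dots> \<le> 1" using r \<sigma>(1) mult_left_le[of \<sigma> r] by auto
    finally have "cmod w0 * cmod (of_real (1 - r) + \<i> * of_real (r * \<sigma>)) \<le> 1 * 1"
      using w0(2) by (intro mult_mono) auto
    then show ?thesis unfolding g(3)[OF r] line norm_mult by simp
  qed
  have lift_connects: "connects ?E z0 (g \<tau>) (pi * real n)"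
    if \<tau>: "\<tau> \<in> {0..1}" "\<And>r. r \<in> {0..\<tau>} \<Longrightarrow> cmod (g r) \<le> 1" for \<tau>
  proof -
    have sub: "{0..\<tau>} \<subseteq> {0..1}" using \<tau>(1) by auto
    have "length_le g {0..\<tau>} (pi * real n)"
      by (rule length_le_lift_of_segment[OF deg n(1) w continuous_on_subset[OF g(1) sub], of w0])
         (use \<tau>(2) g(3) sub in auto)
    then have "connects ?E (g 0) (g \<tau>) (pi * real n)"
      by (intro connects_restrict continuous_on_subset[OF g(1) sub]) (use \<tau> small sub in auto)
    then show ?thesis by (simp add: g(2))
  qed
  show ?thesis
  proof (cases "\<exists>r\<in>{0..1}. 1 \<le> cmod (g r)")
    case True
    then obtain r where r: "r \<in> {0..1}" "1 \<le> cmod (g r)" by blast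
    have "cmod (g 0) \<le> 1" using g(2) z0 by simp
    then obtain \<tau> where \<tau>: "\<tau> \<in> {0..1}" "cmod (g \<tau>) = 1" "\<And>t. t \<in> {0..\<tau>} \<Longrightarrow> cmod (g t) \<le> 1"
      using first_exit[OF g(1) _ r] by blast
    have "connects ?E 0 (g \<tau>) (t + pi * real n)"
      by (rule connects_join[OF start lift_connects]) (use \<tau> in auto)
    then have "connects ?E 0 (g \<tau>) (pi * real n + \<epsilon>)" by (rule connects_mono) (use t(1) eps in auto)
    then show ?thesis using \<tau>(2) by blast
  next
    case False
    \<comment> \<open>The end value has modulus \<open>cmod w0 * \<sigma> \<le> h\<close>, so
      \<open>g 1\<close> is within \<open>d\<close> of a root \<open>b\<close>. As \<open>b\<close>
      is outside the open disc, the short segment to \<open>b\<close> meets the circle.\<close>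
    then have lt: "\<And>r. r \<in> {0..1} \<Longrightarrow> cmod (g r) \<le> 1" by force
    let ?z = "g 1"
    have z: "cmod ?z \<le> 1" using lt by simp
    have "poly F ?z = w0 * (\<i> * of_real \<sigma>)" using g(3)[of 1] line[of 1] by simp
    then have "cmod (poly F ?z) = cmod w0 * \<sigma>" using \<sigma>(1) by (simp add: norm_mult)
    also have "\<dots> \<le> 1 * h" using w0(2) \<sigma>(1) by (intro mult_mono) auto
    finally obtain b where b: "poly F b = 0" "cmod (?z - b) < d" using h(2)[OF z] by auto
    have b1: "1 \<le> cmod b" using roots b(1) .
    have near: "cmod (poly F x) \<le> 1" if x: "x \<in> closed_segment ?z b" for x
    proof -
      have "cmod b \<le> 2" using b(2) z norm_triangle_ineq2[of b ?z] by (simp add: d_def norm_minus_commute)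
      moreover have "dist x b \<le> cmod (?z - b)" using segment_bound(2)[OF x] by (simp add: dist_norm norm_minus_commute)
      moreover from calculation have "cmod x \<le> 3"
        using b(2) norm_triangle_ineq2[of x b] by (simp add: d_def dist_norm)
      ultimately have "dist (poly F x) (poly F b) < 1" using b(2) by (intro d1(2)) (auto simp: d_def)
      then show ?thesis by (simp add: b(1))
    qed
    have s1: "(1::real) \<in> {0..1}" by simp
    have "cmod (linepath ?z b 0) \<le> 1" "1 \<le> cmod (linepath ?z b 1)" using z b1 by (simp_all add: linepath_def)
    then obtain \<tau> where \<tau>: "\<tau> \<in> {0..1}" "cmod (linepath ?z b \<tau>) = 1" "\<And>t. t \<in> {0..\<tau>} \<Longrightarrow> cmod (linepath ?z b t) \<le> 1"
      using first_exit[OF continuous_on_linepath _ s1] by blast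
    have "length_le (linepath ?z b) {0..\<tau>} (\<epsilon>/2)"
      by (rule length_le_mono[OF length_le_linepath]) (use \<tau>(1) b(2) in \<open>auto simp: dist_norm d_def\<close>)
    then have "connects ?E (linepath ?z b 0) (linepath ?z b \<tau>) (\<epsilon>/2)"
      by (intro connects_restrict continuous_on_linepath)
         (use \<tau> near linepath_in_path[of _ ?z b] in auto)
    then have "connects ?E ?z (linepath ?z b \<tau>) (\<epsilon>/2)" by (simp add: linepath_def)
    from connects_join[OF connects_join[OF start lift_connects[OF s1 lt]] this]
    have "connects ?E 0 (linepath ?z b \<tau>) (t + pi * real n + \<epsilon>/2)" .
    then have "connects ?E 0 (linepath ?z b \<tau>) (pi * real n + \<epsilon>)" by (rule connects_mono) (use t(1) in auto)
    then show ?thesis using \<tau>(2) by blast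
  qed
qed

lemma escape_length_upper:
  assumes n: "1 \<le> n"
  shows "escape_length n \<le> ereal (pi * real n)"
  unfolding escape_length_def
proof (rule SUP_least)
  fix f assume "f \<in> monic_disc_polys n"
  then obtain a where f: "f = (\<Prod>j=1..n. [:- a j, 1:])" and a: "\<And>j. j \<in> {1..n} \<Longrightarrow> cmod (a j) \<le> 1"
    by (auto simp: monic_disc_polys_def)
  \<comment> \<open>Replacing \<open>z - a j\<close> by \<open>1 - cnj (a j) * z\<close> does not
    decrease the modulus on the closed disc, so a path for \<open>F\<close> is a path for
    \<open>f\<close>. The degree falls below \<open>n\<close> if some \<open>a j\<close> is
    \<open>0\<close>.\<close>
  define F where "F = (\<Prod>j=1..n. [:1, - cnj (a j):])"
  have Fz: "poly F z = (\<Prod>j=1..n. 1 - cnj (a j) * z)" for z by (simp add: F_def poly_prod mult.commute)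
  have "degree F \<le> (\<Sum>j=1..n. degree [:1, - cnj (a j):])"
    unfolding F_def using degree_prod_sum_le[of "{1..n}" "\<lambda>j. [:1, - cnj (a j):]"] by (simp only: finite_atLeastAtMost o_def)
  also have "\<dots> \<le> (\<Sum>j=1..n. 1)" by (intro sum_mono) auto
  finally have deg: "degree F \<le> n" by simp
  have F0: "poly F 0 = 1" by (simp add: Fz)
  have roots: "1 \<le> cmod b" if b: "poly F b = 0" for b
  proof -
    obtain j where j: "j \<in> {1..n}" "cnj (a j) * b = 1" using b by (auto simp: Fz)
    then have "cmod (a j) * cmod b = 1" by (metis complex_mod_cnj norm_mult norm_one)
    moreover have "cmod (a j) * cmod b \<le> 1 * cmod b" using a[OF j(1)] by (intro mult_right_mono) auto
    ultimately show ?thesis by simp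
  qed
  have le: "cmod (poly f z) \<le> cmod (poly F z)" if z: "cmod z \<le> 1" for z
  proof -
    have "cmod (z - a j) \<le> cmod (1 - cnj (a j) * z)" if j: "j \<in> {1..n}" for j
    proof (rule power2_le_imp_le)
      have "0 \<le> (1 - (cmod z)\<^sup>2) * (1 - (cmod (a j))\<^sup>2)"
        using z a[OF j] by (intro mult_nonneg_nonneg) (auto simp: power_le_one)
      then show "(cmod (z - a j))\<^sup>2 \<le> (cmod (1 - cnj (a j) * z))\<^sup>2"
        using disc_factor_identity[of "a j" z] by linarith
    qed simp
    then show ?thesis unfolding f Fz poly_prod prod_norm[symmetric]
      by (intro prod_mono) (auto simp: algebra_simps)
  qed
  show "(INF g\<in>escape_paths f. path_length g) \<le> ereal (pi * real n)"
  proof (rule ereal_le_epsilon2)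
    fix \<epsilon> :: real assume "0 < \<epsilon>"
    then obtain \<zeta> where \<zeta>: "cmod \<zeta> = 1"
      "connects {z. cmod z \<le> 1 \<and> cmod (poly F z) \<le> 1} 0 \<zeta> (pi * real n + \<epsilon>)"
      using short_exit_path[OF deg n F0 roots] by blast
    then obtain g where g: "path g" "path_image g \<subseteq> {z. cmod z \<le> 1 \<and> cmod (poly F z) \<le> 1}"
      "pathstart g = 0" "pathfinish g = \<zeta>" "length_le g {0..1} (pi * real n + \<epsilon>)"
      unfolding connects_def by blast
    have len: "path_length g \<le> ereal (pi * real n + \<epsilon>)" using path_length_le[OF g(5)] .
    then have "path_length g < \<infinity>" by (metis ereal_infty_less(1) ereal_infty_less_eq(1) PInfty_neq_ereal(1))
    moreover have "path_image g \<subseteq> lemniscate_disc f"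
    proof
      fix z assume "z \<in> path_image g"
      then have z: "cmod z \<le> 1" "cmod (poly F z) \<le> 1" using g(2) by auto
      then show "z \<in> lemniscate_disc f"
        using order_trans[OF le[OF z(1)] z(2)] by (simp add: lemniscate_disc_def)
    qed
    ultimately have "g \<in> escape_paths f"
      using g \<zeta>(1) by (simp add: escape_paths_def rectifiable_path_def)
    then show "(INF g\<in>escape_paths f. path_length g) \<le> ereal (pi * real n) + ereal \<epsilon>"
      using len by (auto intro: INF_lower2)
  qed
qed

section \<open>Pole pushing\<close>

text \<open>The polynomial \<open>x \<mapsto> P(Bin(2M, 1 - x) \<ge> M)\<close>: it is close to \<open>1\<close> near \<open>x = 0\<close> and divisible
  by \<open>(1 - x)^M\<close>, so it can cancel poles of order \<open>M\<close> at \<open>x = 1\<close>.\<close>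

definition binom_tail :: "nat \<Rightarrow> complex \<Rightarrow> complex" where
  "binom_tail M x = (\<Sum>j=M..2*M. of_nat (2*M choose j) * (1 - x)^j * x^(2*M - j))"

text \<open>By the binomial theorem the deviation from \<open>1\<close> is the sum over
  \<open>j < M\<close>, whose terms have at least \<open>M\<close> factors \<open>x\<close>. The
  coefficients total at most \<open>4^M\<close>, which leaves
  \<open>(4 * 17/16 * 1/16)^M = (17/64)^M\<close>.\<close>

lemma binom_tail_close:
  assumes "cmod x \<le> 1/16"
  shows "cmod (binom_tail M x - 1) \<le> (1/2)^M"
proof -
  let ?g = "\<lambda>j. of_nat (2*M choose j) * (1 - x)^j * x^(2*M - j)"
  have "(1::complex) = ((1 - x) + x)^(2*M)" by simp
  also have "\<dots> = (\<Sum>j\<le>2*M. ?g j)" by (simp only: binomial_ring)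
  also have "{..2*M} = {..<M} \<union> {M..2*M}" by auto
  also have "(\<Sum>j\<in>{..<M} \<union> {M..2*M}. ?g j) = (\<Sum>j<M. ?g j) + binom_tail M x"
    unfolding binom_tail_def by (rule sum.union_disjoint) auto
  finally have "binom_tail M x - 1 = - (\<Sum>j<M. ?g j)" by (simp add: algebra_simps)
  then have "cmod (binom_tail M x - 1) = cmod (\<Sum>j<M. ?g j)" by simp
  also have "\<dots> \<le> (\<Sum>j<M. real (2*M choose j) * ((17/16)^M * (1/16)^M))"
  proof (rule sum_norm_le)
    fix j assume "j \<in> {..<M}"
    then have j: "j < M" by simp
    have a: "cmod (1 - x) \<le> 17/16" using assms norm_triangle_ineq4[of 1 x] by simp
    have b: "cmod (1 - x)^j \<le> (17/16)^M"
      by (rule order_trans[OF power_mono[OF a norm_ge_zero]]) (use j in \<open>simp add: power_increasing\<close>)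
    have c: "cmod x^(2*M - j) \<le> (1/16)^M"
    proof -
      have "cmod x^(2*M - j) \<le> (1/16)^(2*M - j)" by (rule power_mono[OF assms norm_ge_zero])
      also have "\<dots> \<le> (1/16)^M" by (rule power_decreasing) (use j in auto)
      finally show ?thesis .
    qed
    have "cmod (?g j) = real (2*M choose j) * (cmod (1 - x)^j * cmod x^(2*M - j))"
      by (simp add: norm_mult norm_power)
    also have "\<dots> \<le> real (2*M choose j) * ((17/16)^M * (1/16)^M)"
      by (intro mult_left_mono mult_mono b c) auto
    finally show "cmod (?g j) \<le> real (2*M choose j) * ((17/16)^M * (1/16)^M)" .
  qed
  also have "\<dots> = real (\<Sum>j<M. 2*M choose j) * ((17/16)^M * (1/16)^M)"
    by (simp add: sum_distrib_right)
  also have "\<dots> \<le> 2^(2*M) * ((17/16)^M * (1/16)^M)"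
  proof (rule mult_right_mono)
    have "(\<Sum>j<M. 2*M choose j) \<le> (\<Sum>j\<le>2*M. 2*M choose j)" by (rule sum_mono2) auto
    also have "\<dots> = 2^(2*M)" by (rule choose_row_sum)
    finally show "real (\<Sum>j<M. 2*M choose j) \<le> 2^(2*M)" by (metis of_nat_le_iff of_nat_numeral of_nat_power)
  qed auto
  also have "\<dots> = (17/64)^M" by (simp add: power_mult power_mult_distrib[symmetric])
  also have "\<dots> \<le> (1/2)^M" by (rule power_mono) auto
  finally show ?thesis .
qed

text \<open>A bound without smallness of \<open>x\<close>, for use on the circle of radius
  \<open>20\<close>.\<close>

lemma binom_tail_bound: "cmod (binom_tail M x) \<le> (1 + 2 * cmod x)^(2*M)"
proof -
  have "cmod (binom_tail M x) \<le> (\<Sum>j=M..2*M. of_nat (2*M choose j) * (1 + cmod x)^j * cmod x^(2*M - j))"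
    unfolding binom_tail_def
  proof (rule sum_norm_le)
    fix j
    have "cmod (1 - x) \<le> 1 + cmod x" using norm_triangle_ineq4[of 1 x] by simp
    then show "cmod (of_nat (2*M choose j) * (1 - x)^j * x^(2*M - j)) \<le>
        of_nat (2*M choose j) * (1 + cmod x)^j * cmod x^(2*M - j)"
      by (auto simp: norm_mult norm_power intro!: mult_mono power_mono)
  qed
  also have "\<dots> \<le> (\<Sum>j\<le>2*M. of_nat (2*M choose j) * (1 + cmod x)^j * cmod x^(2*M - j))"
    by (rule sum_mono2) auto
  also have "\<dots> = ((1 + cmod x) + cmod x)^(2*M)" by (simp only: binomial_ring)
  finally show ?thesis by (simp add: algebra_simps)
qed

text \<open>\<open>R\<close> is \<open>P\<close> of the fraction times \<open>(1 - d * y)^M\<close>,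
  and \<open>S\<close> is \<open>binom_tail M (d * y)\<close> with that power divided out, so the
  poles cancel in \<open>R * S\<close>. The constants \<open>\<alpha>\<close>,
  \<open>\<beta>\<close> cover both a move between finite poles and the move of a pole to
  infinity.\<close>

lemma poly_clear_denominator:
  fixes P :: "complex poly"
  assumes "degree P \<le> M"
  obtains P' where "degree P' \<le> 2*M"
    "\<And>y. d * y \<noteq> 1 \<Longrightarrow> poly P' y = poly P ((\<alpha> + \<beta> * y) / (1 - d * y)) * binom_tail M (d * y)"
proof
  define S where "S = (\<Sum>j=M..2*M. smult (of_nat (2*M choose j)) ([:1, -d:]^(j - M) * [:0, d:]^(2*M - j)))"
  define R where "R = (\<Sum>i\<le>M. smult (coeff P i) ([:\<alpha>, \<beta>:]^i * [:1, -d:]^(M - i)))"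
  have lin: "degree ([:a, b:]^i) \<le> i" for a b :: complex and i
    using degree_power_le[of "[:a, b:]" i] by (auto intro: order_trans[OF _ ] simp: split: if_splits)
  have lin2: "degree ([:a, b:]^i * [:a', b':]^k) \<le> i + k" for a b a' b' :: complex and i k
    using order_trans[OF degree_mult_le add_mono[OF lin lin]] .
  have "degree S \<le> M" unfolding S_def
    by (intro degree_sum_le order_trans[OF degree_smult_le] order_trans[OF lin2]) auto
  moreover have "degree R \<le> M" unfolding R_def
    by (intro degree_sum_le order_trans[OF degree_smult_le] order_trans[OF lin2]) auto
  ultimately show "degree (R * S) \<le> 2*M" using degree_mult_le[of R S] by simp
  fix y assume y: "d * y \<noteq> 1"
  let ?x = "1 - d * y"
  have x: "?x \<noteq> 0" using y by simp
  have 1: "poly R y = ?x^M * poly P ((\<alpha> + \<beta> * y) / ?x)"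
  proof -
    have "poly P ((\<alpha> + \<beta> * y) / ?x) = (\<Sum>i\<le>M. coeff P i * ((\<alpha> + \<beta> * y) / ?x)^i)"
      unfolding poly_altdef by (rule sum.mono_neutral_left) (use assms in \<open>auto simp: coeff_eq_0\<close>)
    also have "?x^M * \<dots> = (\<Sum>i\<le>M. coeff P i * ((\<alpha> + \<beta> * y)^i * ?x^(M - i)))"
      unfolding sum_distrib_left
    proof (rule sum.cong[OF refl])
      fix i assume "i \<in> {..M}"
      then have "?x^M = ?x^i * ?x^(M - i)" by (simp flip: power_add)
      then show "?x^M * (coeff P i * ((\<alpha> + \<beta> * y) / ?x)^i) = coeff P i * ((\<alpha> + \<beta> * y)^i * ?x^(M - i))"
        using x by (simp add: power_divide)
    qed
    finally show ?thesis unfolding R_def by (simp add: poly_sum algebra_simps)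
  qed
  have 2: "binom_tail M (d * y) = ?x^M * poly S y"
  proof -
    have "?x^M * poly S y = (\<Sum>j=M..2*M. ?x^M * (of_nat (2*M choose j) * (?x^(j - M) * (d * y)^(2*M - j))))"
      unfolding S_def poly_sum sum_distrib_left by (simp add: mult.commute)
    also have "\<dots> = binom_tail M (d * y)" unfolding binom_tail_def
    proof (rule sum.cong[OF refl])
      fix j assume "j \<in> {M..2*M}"
      then have "?x^j = ?x^M * ?x^(j - M)" by (simp flip: power_add)
      then show "?x^M * (of_nat (2*M choose j) * (?x^(j - M) * (d * y)^(2*M - j))) =
          of_nat (2*M choose j) * ?x^j * (d * y)^(2*M - j)" by (simp only: mult_ac)
    qed
    finally show ?thesis by simp
  qed
  show "poly (R * S) y = poly P ((\<alpha> + \<beta> * y) / ?x) * binom_tail M (d * y)"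
    by (simp only: poly_mult 1 2 mult_ac)
qed

text \<open>The constant \<open>16\<close> makes the quotient of \<open>a - b\<close> by
  \<open>w - b\<close> small enough for \<open>binom_tail_close\<close>.\<close>

definition pole_step :: "complex set \<Rightarrow> complex \<Rightarrow> complex \<Rightarrow> bool" where
  "pole_step K a b \<longleftrightarrow> b \<notin> K \<and> (\<forall>w\<in>K. cmod (b - a) \<le> cmod (w - b) / 16)"

text \<open>As \<open>cmod p \<le> 2\<close> and \<open>k + 4 \<le> 2^(k+2)\<close>, the factor
  \<open>t\<close> adds an error of at most \<open>2 * (1/2)^(k+4)\<close>, exactly the difference
  of the two bounds.\<close>

lemma error_step:
  fixes p t :: complex
  assumes "cmod (p - 1) \<le> 1/2 - 1/2^(k+2)" "cmod (t - 1) \<le> (1/2)^(2^(k+2))"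
  shows "cmod (p * t - 1) \<le> 1/2 - 1/2^(k+3)"
proof -
  have "1/2 - 1/2^(k+2) \<le> (1/2::real)" by simp
  then have p: "cmod p \<le> 2" using assms(1) norm_triangle_sub[of p 1] unfolding norm_one by linarith
  have "k + 4 \<le> 2^(k+2)" by (induction k) auto
  then have "(1/2::real)^(2^(k+2)) \<le> (1/2)^(k+4)" by (intro power_decreasing) auto
  then have t: "cmod (t - 1) \<le> (1/2)^(k+4)" using assms(2) by linarith
  have "p * t - 1 = p * (t - 1) + (p - 1)" by (simp add: algebra_simps)
  then have "cmod (p * t - 1) \<le> cmod p * cmod (t - 1) + cmod (p - 1)"
    by (metis norm_mult norm_triangle_ineq)
  also have "cmod p * cmod (t - 1) \<le> 2 * (1/2)^(k+4)" by (intro mult_mono p t) auto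
  finally show ?thesis using assms(1) by (simp add: power_add power_divide)
qed

text \<open>Each move multiplies by a \<open>binom_tail\<close> whose order is the current degree
  bound; the degree bound doubles and the accumulated error stays below \<open>1/2\<close>. The
  factor \<open>z\<close> makes \<open>z * (1/z) = 1\<close> an exact start and later supplies the
  zero at \<open>0\<close>.\<close>

lemma pole_push:
  assumes "(pole_step K ^^ k) 0 a" "0 \<notin> K"
  shows "a \<notin> K \<and> (\<exists>P. degree P \<le> 2^(k+2) \<and>
           (\<forall>z\<in>K. cmod (z * poly P (1 / (z - a)) - 1) \<le> 1/2 - 1/2^(k+2)))"
  using assms(1)
proof (induction k arbitrary: a)
  case 0
  have "degree [:0, 1::complex:] \<le> 2^(0+2)" by simp
  moreover have "\<forall>z\<in>K. cmod (z * poly [:0, 1:] (1 / (z - 0)) - 1) \<le> 1/2 - 1/2^(0+2)"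
    using assms(2) by auto
  moreover have "a = 0" using 0 by simp
  ultimately show ?case using assms(2) by blast
next
  case (Suc k)
  then obtain b where b: "(pole_step K ^^ k) 0 b" and st: "pole_step K b a" by auto
  from Suc.IH[OF b] obtain P where bK: "b \<notin> K" and P: "degree P \<le> 2^(k+2)"
    and P1: "\<And>z. z \<in> K \<Longrightarrow> cmod (z * poly P (1 / (z - b)) - 1) \<le> 1/2 - 1/2^(k+2)" by blast
  obtain P' where P': "degree P' \<le> 2*2^(k+2)" and eq: "\<And>y. (b - a) * y \<noteq> 1 \<Longrightarrow>
      poly P' y = poly P ((0 + 1 * y) / (1 - (b - a) * y)) * binom_tail (2^(k+2)) ((b - a) * y)"
    using poly_clear_denominator[OF P] by blast
  have aK: "a \<notin> K" using st by (simp add: pole_step_def)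
  have "cmod (z * poly P' (1 / (z - a)) - 1) \<le> 1/2 - 1/2^(k+3)" if z: "z \<in> K" for z
  proof -
    have za: "z - a \<noteq> 0" and zb: "z - b \<noteq> 0" using aK bK z by auto
    have x: "cmod ((b - a) * (1 / (z - a))) \<le> 1/16"
      using st z za unfolding pole_step_def by (auto simp: norm_divide field_simps norm_minus_commute)
    then have "(b - a) * (1 / (z - a)) \<noteq> 1" by auto
    from eq[OF this] have "poly P' (1 / (z - a)) =
       poly P ((1 / (z - a)) / (1 - (b - a) * (1 / (z - a)))) * binom_tail (2^(k+2)) ((b - a) * (1 / (z - a)))"
      by simp
    also have "(1 / (z - a)) / (1 - (b - a) * (1 / (z - a))) = 1 / (z - b)"
      using za zb by (simp add: field_simps)
    finally have "z * poly P' (1 / (z - a)) =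
      (z * poly P (1 / (z - b))) * binom_tail (2^(k+2)) ((b - a) * (1 / (z - a)))" by simp
    then show ?thesis using error_step[OF P1[OF z] binom_tail_close[OF x]] by (simp only:)
  qed
  with P' aK show ?case by (intro conjI exI[of _ P']) (auto simp: numeral_3_eq_3)
qed

text \<open>The last move sends the pole from \<open>a\<close> to infinity, which leaves a
  polynomial. The circle of radius \<open>20\<close> serves the growth bound:
  \<open>z * poly P (1 / (z - a))\<close> is still bounded by \<open>2\<close> on it, and the
  maximum principle carries the resulting estimate to the unit disc.\<close>

lemma pole_push_to_infinity:
  assumes "(pole_step (W \<union> sphere 0 20) ^^ k) 0 a" "0 \<notin> W" "W \<subseteq> cball 0 1" "16 \<le> cmod a"
  obtains G where "degree G \<le> 2^(k+3) + 1" "poly G 0 = 0" "\<And>z. z \<in> W \<Longrightarrow> cmod (poly G z - 1) \<le> 1/2"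
    "\<And>z. z \<in> cball 0 1 \<Longrightarrow> cmod (poly G z) \<le> 2 * 13^(2^(k+2))"
proof -
  let ?M = "2^(k+2) :: nat"
  obtain P where aK: "a \<notin> W \<union> sphere 0 20" and P: "degree P \<le> ?M"
    and P1: "\<And>z. z \<in> W \<union> sphere 0 20 \<Longrightarrow> cmod (z * poly P (1 / (z - a)) - 1) \<le> 1/2 - 1/2^(k+2)"
    using pole_push[OF assms(1)] assms(2) by auto
  have a0: "a \<noteq> 0" using assms(4) by auto
  obtain P' where P': "degree P' \<le> 2*?M" and eq: "\<And>y. (1/a) * y \<noteq> 1 \<Longrightarrow>
      poly P' y = poly P ((- 1/a + 0 * y) / (1 - (1/a) * y)) * binom_tail ?M ((1/a) * y)"
    using poly_clear_denominator[OF P] by blast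
  define G where "G = [:0, 1:] * P'"
  have eq': "poly G z = (z * poly P (1 / (z - a))) * binom_tail ?M (z/a)" if "z \<noteq> a" for z
  proof -
    have "(1/a) * z \<noteq> 1" using that a0 by (auto simp: field_simps)
    moreover have "(- 1/a + 0 * z) / (1 - (1/a) * z) = 1 / (z - a)"
      using that a0 by (simp add: field_simps)
    ultimately show ?thesis using eq[of z] unfolding G_def by simp
  qed
  show thesis
  proof
    show "degree G \<le> 2^(k+3) + 1"
      using degree_mult_le[of "[:0, 1:]" P'] P' unfolding G_def by (simp add: power_add)
    show "poly G 0 = 0" by (simp add: G_def)
    show "cmod (poly G z - 1) \<le> 1/2" if z: "z \<in> W" for z
    proof -
      have "cmod z \<le> 1" using z assms(3) by auto
      then have "cmod (z / a) \<le> 1/16" using assms(4) a0 by (auto simp: norm_divide field_simps)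
      then have "cmod (z * poly P (1 / (z - a)) * binom_tail ?M (z/a) - 1) \<le> 1/2 - 1/2^(k+3)"
        by (intro error_step binom_tail_close P1) (use z in auto)
      moreover have "1/2 - 1/2^(k+3) \<le> (1/2::real)" by simp
      moreover have "z \<noteq> a" using aK z by auto
      ultimately show ?thesis unfolding eq'[OF \<open>z \<noteq> a\<close>] by linarith
    qed
    have sph: "cmod (poly G z) \<le> 2 * 13^?M" if z: "z \<in> sphere 0 20" for z
    proof -
      have "cmod (z * poly P (1 / (z - a)) - 1) \<le> 1/2"
        by (rule order_trans[OF P1]) (use z in auto)
      then have 1: "cmod (z * poly P (1 / (z - a))) \<le> 2"
        using norm_triangle_sub[of "z * poly P (1 / (z - a))" 1] by simp
      \<comment> \<open>\<open>20/16 = 5/4\<close>, \<open>1 + 2 * 5/4 = 7/2\<close>, and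
        \<open>(7/2)^2 \<le> 13\<close>.\<close>
      have "cmod (z/a) \<le> 5/4" using z assms(4) a0 by (auto simp: norm_divide field_simps)
      then have "(1 + 2 * cmod (z/a))^(2*?M) \<le> (7/2)^(2*?M)" by (intro power_mono) auto
      also have "\<dots> \<le> 13^?M" unfolding power_mult by (intro power_mono) (auto simp: power2_eq_square)
      finally have 2: "cmod (binom_tail ?M (z/a)) \<le> 13^?M" using binom_tail_bound[of ?M "z/a"] by linarith
      have "z \<noteq> a" using aK z by auto
      show ?thesis unfolding eq'[OF \<open>z \<noteq> a\<close>] norm_mult[of "z * poly P _"] by (rule mult_mono[OF 1 2]) auto
    qed
    show "cmod (poly G z) \<le> 2 * 13^?M" if "z \<in> cball 0 1" for z
      by (rule maximum_modulus_frontier[of "poly G" "cball 0 20"])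
         (use that sph in \<open>auto intro!: holomorphic_intros continuous_intros\<close>)
  qed
qed

section \<open>The labyrinth\<close>

text \<open>Samples at equidistant parameters are at distance at most
  \<open>L / m \<le> d / 16\<close> from their neighbours.\<close>

lemma pole_steps_along_curve:
  assumes lip: "\<And>s t. s \<in> {0..1} \<Longrightarrow> t \<in> {0..1} \<Longrightarrow> cmod (g s - g t) \<le> L * \<bar>s - t\<bar>"
    and far: "\<And>t w. t \<in> {0..1} \<Longrightarrow> w \<in> K \<Longrightarrow> d \<le> cmod (w - g t)"
    and d: "0 < d" and m: "0 < m" "16 * L \<le> d * real m"
  shows "(pole_step K ^^ m) (g 0) (g 1)"
proof -
  have "(pole_step K ^^ i) (g 0) (g (real i / real m))" if "i \<le> m" for i
    using that
  proof (induction i)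
    case (Suc i)
    have in01: "real i / real m \<in> {0..1}" "real (Suc i) / real m \<in> {0..1}" using Suc.prems m by auto
    have "cmod (g (real (Suc i) / real m) - g (real i / real m)) \<le> L * \<bar>real (Suc i) / real m - real i / real m\<bar>"
      using lip in01 by blast
    also have "\<dots> = L / real m" by (simp add: diff_divide_distrib[symmetric])
    also have "\<dots> \<le> d / 16" using m by (simp add: field_simps)
    finally have le: "cmod (g (real (Suc i) / real m) - g (real i / real m)) \<le> d / 16" .
    have "pole_step K (g (real i / real m)) (g (real (Suc i) / real m))"
      unfolding pole_step_def
    proof
      show "g (real (Suc i) / real m) \<notin> K" using far[OF in01(2)] d by force
      show "\<forall>w\<in>K. cmod (g (real (Suc i) / real m) - g (real i / real m)) \<le> cmod (w - g (real (Suc i) / real m)) / 16"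
        using far[OF in01(2)] le by fastforce
    qed
    then show ?case using Suc by auto
  qed auto
  from this[of m] m show ?thesis by simp
qed

text \<open>Equidistant radii ending at \<open>1/2\<close>, so that high powers of \<open>z\<close>
  are small on all rings.\<close>

definition ring_radius :: "nat \<Rightarrow> nat \<Rightarrow> real" where
  "ring_radius N j = 1/4 + real j / (4 * real N)"

text \<open>The gap of ring \<open>j\<close> is an arc around the positive real axis for even
  \<open>j\<close> and around the negative one for odd \<open>j\<close>.\<close>

definition labyrinth :: "nat \<Rightarrow> complex set" where
  "labyrinth N = {w. \<exists>j\<in>{1..N}. cmod w = ring_radius N j \<and> (-1)^j * Re w \<le> ring_radius N j / 2}"

lemma labyrinth_annulus:
  assumes "w \<in> labyrinth N"
  shows "cmod w \<le> 1/2" "1/4 \<le> cmod w"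
proof -
  obtain j where j: "1 \<le> j" "j \<le> N" "cmod w = ring_radius N j" using assms by (auto simp: labyrinth_def)
  have "real j / (4 * real N) \<le> 1/4" using j by (simp add: divide_le_eq)
  with j(3) show "cmod w \<le> 1/2" unfolding ring_radius_def by linarith
  show "1/4 \<le> cmod w" using j(3) by (simp add: ring_radius_def)
qed

text \<open>The route passes a gap along the real axis into the corridor of radius
  \<open>\<rho> j\<close>, follows a half circle to the other side, and repeats. Its
  \<open>2 * N + 2\<close> pieces are the initial segment, a segment and a half circle per ring, and
  a final segment to modulus \<open>16\<close>.\<close>

lemma pole_steps_out_of_labyrinth:
  assumes N: "2 \<le> N"
  obtains a where "(pole_step (labyrinth N \<union> sphere 0 20) ^^ (2048 * N * (2 * N + 2))) 0 a" "cmod a = 16"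
proof -
  \<comment> \<open>The clearance is half the distance of consecutive rings. Each piece has
    Lipschitz constant at most \<open>16\<close>, so \<open>16 * 16 / d = 2048 * N\<close> moves per
    piece suffice.\<close>
  define d where "d = 1 / (8 * real N)"
  define \<rho> where "\<rho> j = 1/4 + (2 * real j + 1) / (8 * real N)" for j
  define m where "m = 2048 * N"
  let ?K = "labyrinth N \<union> sphere 0 20"
  let ?r = "ring_radius N"
  have d: "0 < d" "d \<le> 1/16" using N by (auto simp: d_def field_simps)
  have m: "0 < m" "16 * 16 \<le> d * real m" using N by (auto simp: d_def m_def)
  have r1: "?r j = \<rho> j - d" for j using N by (simp add: ring_radius_def \<rho>_def d_def field_simps)
  have r2: "?r (Suc j) = \<rho> j + d" for j using N by (simp add: ring_radius_def \<rho>_def d_def field_simps)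
  have rmono: "i \<le> j \<Longrightarrow> ?r i \<le> ?r j" for i j using N by (simp add: ring_radius_def field_simps)
  have \<rho>0: "0 < \<rho> j" for j by (simp add: \<rho>_def add_pos_nonneg)
  have \<rho>N: "\<rho> j \<le> 1" if "j \<le> N" for j
    using that N r1[of j] rmono[of j N] d by (simp add: ring_radius_def)
  \<comment> \<open>Distance from a ring is obtained from the difference of radii, except for the
    ring being crossed, where it is checked directly.\<close>
  have far: "d \<le> cmod (w - z)"
    if w: "w \<in> ?K" and z: "cmod z \<le> 16" and rings: "\<And>j. j \<in> {1..N} \<Longrightarrow> cmod w = ?r j \<Longrightarrow>
      (-1)^j * Re w \<le> ?r j / 2 \<Longrightarrow> d \<le> \<bar>?r j - cmod z\<bar> \<or> d \<le> cmod (w - z)" for w z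
  proof (cases "w \<in> sphere 0 20")
    case True
    then have "cmod w = 20" by simp
    then show ?thesis using z d norm_triangle_ineq2[of w z] by linarith
  next
    case False
    then obtain j where j: "j \<in> {1..N}" "cmod w = ?r j" "(-1)^j * Re w \<le> ?r j / 2"
      using w by (auto simp: labyrinth_def)
    show ?thesis using rings[OF j] j(2) norm_triangle_ineq3[of w z] by auto
  qed
  have segment: "(pole_step ?K ^^ m) (of_real x) (of_real y)"
    if "\<bar>x\<bar> \<le> 16" "\<bar>y\<bar> \<le> 16" "\<bar>y - x\<bar> \<le> 16"
      and *: "\<And>u w. u \<in> closed_segment x y \<Longrightarrow> w \<in> ?K \<Longrightarrow> d \<le> cmod (w - of_real u)" for x y :: real
  proof -
    let ?g = "\<lambda>t. complex_of_real (linepath x y t)"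
    have "(pole_step ?K ^^ m) (?g 0) (?g 1)"
    proof (rule pole_steps_along_curve[OF _ _ d(1) m])
      fix s t :: real
      have "?g s - ?g t = of_real ((y - x) * (s - t))" by (simp add: linepath_def algebra_simps)
      then have "cmod (?g s - ?g t) = \<bar>y - x\<bar> * \<bar>s - t\<bar>" by (simp only: norm_of_real abs_mult)
      then show "cmod (?g s - ?g t) \<le> 16 * \<bar>s - t\<bar>" using that(3) by (simp add: mult_right_mono)
    next
      fix t :: real and w assume "t \<in> {0..1}" "w \<in> ?K"
      then show "d \<le> cmod (w - ?g t)" by (intro * linepath_in_path) auto
    qed
    then show ?thesis by (simp add: linepath_def)
  qed
  have semicircle: "(pole_step ?K ^^ m) (of_real x) (of_real (-x))" if x: "\<bar>x\<bar> = \<rho> j" "j \<le> N" for x j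
  proof -
    let ?g = "\<lambda>t. complex_of_real x * cis (pi * t)"
    have "(pole_step ?K ^^ m) (?g 0) (?g 1)"
    proof (rule pole_steps_along_curve[OF _ _ d(1) m])
      fix s t :: real
      have "cis (pi * s) - cis (pi * t) = cis (pi * t) * (cis (pi * (s - t)) - 1)"
        by (simp add: algebra_simps cis_mult)
      then have "cmod (cis (pi * s) - cis (pi * t)) = cmod (cis (pi * (s - t)) - 1)"
        by (simp add: norm_mult)
      also have "\<dots> = 2 * \<bar>sin (pi * (s - t) / 2)\<bar>"
        unfolding cis_conv_exp by (rule dist_exp_i_1)
      also have "\<dots> \<le> \<bar>pi * (s - t)\<bar>" using abs_sin_x_le_abs_x[of "pi * (s - t) / 2"] by simp
      also have "\<dots> \<le> 4 * \<bar>s - t\<bar>" using pi_less_4 by (simp add: abs_mult mult_right_mono)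
      finally have 1: "\<bar>x\<bar> * cmod (cis (pi * s) - cis (pi * t)) \<le> 1 * (4 * \<bar>s - t\<bar>)"
        using x \<rho>N by (intro mult_mono) auto
      have "cmod (?g s - ?g t) = \<bar>x\<bar> * cmod (cis (pi * s) - cis (pi * t))"
        by (simp add: right_diff_distrib[symmetric] norm_mult del: of_real_mult)
      also note 1
      also have "1 * (4 * \<bar>s - t\<bar>) \<le> 16 * \<bar>s - t\<bar>" by simp
      finally show "cmod (?g s - ?g t) \<le> 16 * \<bar>s - t\<bar>" .
    next
      fix t :: real and w assume w: "w \<in> ?K"
      have c: "cmod (?g t) = \<rho> j" using x by (simp add: norm_mult)
      show "d \<le> cmod (w - ?g t)"
      proof (rule far[OF w])
        show "cmod (?g t) \<le> 16" using c \<rho>N[OF x(2)] by simp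
        fix i
        have "i \<le> j \<or> Suc j \<le> i" by linarith
        then have "?r i \<le> \<rho> j - d \<or> \<rho> j + d \<le> ?r i" using rmono r1 r2 by metis
        then show "d \<le> \<bar>?r i - cmod (?g t)\<bar> \<or> d \<le> cmod (w - ?g t)" unfolding c by auto
      qed
    qed
    then show ?thesis by simp
  qed
  \<comment> \<open>After passing \<open>j\<close> rings the pole is on the real axis; for
    \<open>j < N\<close> it is in front of the gap of ring \<open>j + 1\<close>.\<close>
  have base: "(pole_step ?K ^^ (m * (2 * j + 1))) 0 (of_real ((-1)^(Suc j) * \<rho> j))" if "j \<le> N" for j
    using that
  proof (induction j)
    case 0
    have "(pole_step ?K ^^ m) (of_real 0) (of_real (- \<rho> 0))"
    proof (rule segment)
      fix u w assume u: "u \<in> closed_segment 0 (- \<rho> 0)" and w: "w \<in> ?K"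
      have u': "\<bar>u\<bar> \<le> \<rho> 0" using u \<rho>0[of 0] by (auto simp: closed_segment_eq_real_ivl split: if_splits)
      show "d \<le> cmod (w - of_real u)"
      proof (rule far[OF w])
        show "cmod (of_real u) \<le> 16" using u' \<rho>N[of 0] by simp
        fix i assume "i \<in> {1..N}"
        then have "\<rho> 0 + d \<le> ?r i" using rmono[of 1 i] r2[of 0] by simp
        then show "d \<le> \<bar>?r i - cmod (of_real u)\<bar> \<or> d \<le> cmod (w - of_real u)"
          using u' d unfolding norm_of_real by linarith
      qed
    qed (use \<rho>N[of 0] \<rho>0[of 0] in auto)
    then show ?case by simp
  next
    case (Suc j)
    define \<sigma> :: real where "\<sigma> = (-1)^(Suc j)"
    have \<sigma>: "\<bar>\<sigma>\<bar> = 1" "\<sigma> * \<sigma> = 1" by (simp_all add: \<sigma>_def power_mult_distrib[symmetric])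
    have inc: "\<rho> j \<le> \<rho> (Suc j)" by (simp add: \<rho>_def divide_right_mono)
    have "(pole_step ?K ^^ (m * (2 * j + 1))) 0 (of_real (\<sigma> * \<rho> j))" using Suc unfolding \<sigma>_def by simp
    moreover have "(pole_step ?K ^^ m) (of_real (\<sigma> * \<rho> j)) (of_real (\<sigma> * \<rho> (Suc j)))"
    proof (rule segment)
      fix u w assume u: "u \<in> closed_segment (\<sigma> * \<rho> j) (\<sigma> * \<rho> (Suc j))" and w: "w \<in> ?K"
      obtain t where "0 \<le> t" "t \<le> 1" "u = (1 - t) * (\<sigma> * \<rho> j) + t * (\<sigma> * \<rho> (Suc j))"
        using u by (auto simp: in_segment)
      then have t: "0 \<le> t" "t \<le> 1" "u = \<sigma> * ((1 - t) * \<rho> j + t * \<rho> (Suc j))" by (auto simp: algebra_simps)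
      define v where "v = (1 - t) * \<rho> j + t * \<rho> (Suc j)"
      have v: "\<rho> j \<le> v" "v \<le> \<rho> (Suc j)" and uv: "u = \<sigma> * v"
        unfolding v_def using t inc convex_bound_le[of "\<rho> j" "\<rho> (Suc j)" "\<rho> (Suc j)" "1 - t" t]
          convex_bound_le[of "- \<rho> j" "- \<rho> j" "- \<rho> (Suc j)" "1 - t" t] by (auto simp: algebra_simps)
      have cu: "cmod (of_real u) = v" unfolding norm_of_real uv abs_mult \<sigma>(1) using v \<rho>0[of j] by simp
      show "d \<le> cmod (w - of_real u)"
      proof (rule far[OF w])
        show "cmod (of_real u) \<le> 16" using cu v \<rho>N[of "Suc j"] Suc.prems by simp
        fix i assume i: "i \<in> {1..N}" "cmod w = ?r i" "(-1)^i * Re w \<le> ?r i / 2"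
        consider "i \<le> j" | "i = Suc j" | "Suc (Suc j) \<le> i" by linarith
        then show "d \<le> \<bar>?r i - cmod (of_real u)\<bar> \<or> d \<le> cmod (w - of_real u)"
        proof cases
          case 1
          then have "?r i \<le> \<rho> j - d" using rmono r1 by metis
          then show ?thesis unfolding cu using v d by (intro disjI1) linarith
        next
          case 3
          then have "\<rho> (Suc j) + d \<le> ?r i" using rmono r2 by metis
          then show ?thesis unfolding cu using v d by (intro disjI1) linarith
        next
          \<comment> \<open>This ring is being crossed. In the direction \<open>\<sigma>\<close> of
            the gap its points have real part at most \<open>(\<rho> j + d) / 2\<close>, whereas
            \<open>v \<ge> \<rho> j \<ge> 1/4 + d\<close>; the difference is at least
            \<open>1/8\<close>.\<close>
          case 2
          define q where "q = \<sigma> * Re w"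
          have "v - q = \<sigma> * Re (of_real u - w)" unfolding q_def using \<sigma>(2) by (simp add: uv algebra_simps)
          also have "\<dots> \<le> \<bar>\<sigma> * Re (of_real u - w)\<bar>" by simp
          also have "\<dots> \<le> cmod (w - of_real u)" unfolding abs_mult \<sigma>(1)
            using abs_Re_le_cmod[of "of_real u - w"] by (simp add: norm_minus_commute)
          finally have "v - q \<le> cmod (w - of_real u)" .
          moreover have "q \<le> (\<rho> j + d) / 2" using i(3) 2 r2[of j] by (simp add: \<sigma>_def q_def)
          moreover have "1/4 \<le> ?r j" by (simp add: ring_radius_def)
          then have "1/4 + d \<le> \<rho> j" using r1[of j] by simp
          ultimately show ?thesis using v d by (intro disjI2) argo
        qed
      qed
    qed (use \<sigma> \<rho>N[of j] \<rho>N[of "Suc j"] \<rho>0[of j] \<rho>0[of "Suc j"] Suc.prems in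
         \<open>auto simp: abs_mult right_diff_distrib[symmetric]\<close>)
    moreover have "(pole_step ?K ^^ m) (of_real (\<sigma> * \<rho> (Suc j))) (of_real (- (\<sigma> * \<rho> (Suc j))))"
      by (rule semicircle[of _ "Suc j"]) (use \<sigma> \<rho>0[of "Suc j"] Suc.prems in \<open>auto simp: abs_mult\<close>)
    ultimately have "(pole_step ?K ^^ (m * (2 * j + 1) + m + m)) 0 (of_real (- (\<sigma> * \<rho> (Suc j))))"
      unfolding relpowp_add by (meson relcomppI)
    moreover have "m * (2 * j + 1) + m + m = m * (2 * Suc j + 1)" by (simp add: algebra_simps)
    moreover have "- (\<sigma> * \<rho> (Suc j)) = (-1)^(Suc (Suc j)) * \<rho> (Suc j)" by (simp add: \<sigma>_def)
    ultimately show ?case by simp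
  qed
  define \<sigma> :: real where "\<sigma> = (-1)^(Suc N)"
  have \<sigma>: "\<bar>\<sigma>\<bar> = 1" by (simp add: \<sigma>_def)
  have "(pole_step ?K ^^ m) (of_real (\<sigma> * \<rho> N)) (of_real (\<sigma> * 16))"
  proof (rule segment)
    fix u w assume u: "u \<in> closed_segment (\<sigma> * \<rho> N) (\<sigma> * 16)" and w: "w \<in> ?K"
    obtain t where "0 \<le> t" "t \<le> 1" "u = (1 - t) * (\<sigma> * \<rho> N) + t * (\<sigma> * 16)"
      using u by (auto simp: in_segment)
    then have t: "0 \<le> t" "t \<le> 1" "u = \<sigma> * ((1 - t) * \<rho> N + t * 16)" by (auto simp: algebra_simps)
    define v where "v = (1 - t) * \<rho> N + t * 16"
    have v: "\<rho> N \<le> v" "v \<le> 16" and uv: "u = \<sigma> * v"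
      unfolding v_def using t \<rho>N[of N] convex_bound_le[of "\<rho> N" 16 16 "1 - t" t]
        convex_bound_le[of "- \<rho> N" "- \<rho> N" "-16" "1 - t" t] by (auto simp: algebra_simps)
    have cu: "cmod (of_real u) = v" unfolding norm_of_real uv abs_mult \<sigma> using v \<rho>0[of N] by simp
    show "d \<le> cmod (w - of_real u)"
    proof (rule far[OF w])
      show "cmod (of_real u) \<le> 16" using cu v by simp
      fix i assume i: "i \<in> {1..N}"
      then have "?r i \<le> \<rho> N - d" using rmono[of i N] r1[of N] by simp
      then show "d \<le> \<bar>?r i - cmod (of_real u)\<bar> \<or> d \<le> cmod (w - of_real u)" unfolding cu using v d by (intro disjI1) linarith
    qed
  qed (use \<sigma> \<rho>N[of N] \<rho>0[of N] in \<open>auto simp: abs_mult right_diff_distrib[symmetric]\<close>)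
  with base[of N] have "(pole_step ?K ^^ (m * (2 * N + 1) + m)) 0 (of_real (\<sigma> * 16))"
    unfolding relpowp_add \<sigma>_def by auto
  moreover have "m * (2 * N + 1) + m = 2048 * N * (2 * N + 2)" by (simp add: m_def algebra_simps)
  moreover have "cmod (of_real (\<sigma> * 16)) = 16" using \<sigma> by (simp add: abs_mult)
  ultimately show ?thesis using that by metis
qed

text \<open>Consecutive rings can only be crossed on opposite sides of the imaginary axis, at distance
  at least \<open>1/8\<close> from it.\<close>

lemma path_length_avoiding_labyrinth:
  assumes g: "path g" "path_image g \<inter> labyrinth N = {}" "g 0 = 0" "cmod (g 1) = 1"
  shows "ereal ((real N - 1) / 4) \<le> path_length g"
proof (cases "N = 0")
  \<comment> \<open>The bound is negative here, and the partition with one step shows that the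
    length is nonnegative.\<close>
  case True
  have "ereal (\<Sum>i<1. dist (g (real i)) (g (real (Suc i)))) \<le> path_length g"
    unfolding path_length_def by (rule SUP_upper2[of "(1, real)"]) (auto simp: mono_on_def)
  moreover have "ereal ((real N - 1) / 4) \<le> ereal (\<Sum>i<1. dist (g (real i)) (g (real (Suc i))))"
    using True by (simp add: order_trans[OF _ zero_le_dist])
  ultimately show ?thesis by (rule order_trans[rotated])
next
  case False
  let ?r = "ring_radius N"
  have cont: "continuous_on {0..1} (\<lambda>t. cmod (g t))" using g(1) by (auto simp: path_def intro: continuous_intros)
  \<comment> \<open>The \<open>t j\<close> are successive times at which the path has the radius of
    ring \<open>j\<close>, found by the intermediate value theorem after the previous time. Adding
    \<open>0\<close> in front and \<open>1\<close> at the end makes them a partition.\<close>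
  define P where "P j x \<longleftrightarrow> x \<in> {0..1} \<and> (j = 0 \<longrightarrow> x = 0) \<and> (j \<in> {1..N} \<longrightarrow> cmod (g x) = ?r j) \<and> (j > N \<longrightarrow> x = (1::real))" for j x
  have "\<exists>t. \<forall>j. P j (t j) \<and> t j \<le> t (Suc j)"
  proof (rule dependent_nat_choice)
    show "\<exists>x. P 0 x" by (auto simp: P_def)
    fix x j assume x: "P j x"
    show "\<exists>y. P (Suc j) y \<and> x \<le> y"
    proof (cases "Suc j \<le> N")
      case True
      have 1: "cmod (g x) \<le> ?r (Suc j)"
        using x True False g(3) by (cases "j = 0") (auto simp: P_def ring_radius_def field_simps)
      have 2: "?r (Suc j) \<le> cmod (g 1)" using True False g(4) by (auto simp: ring_radius_def field_simps)
      have "\<exists>y. x \<le> y \<and> y \<le> 1 \<and> cmod (g y) = ?r (Suc j)"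
        by (rule IVT'[OF 1 2 _ continuous_on_subset[OF cont]]) (use x in \<open>auto simp: P_def\<close>)
      then obtain y where "x \<le> y" "y \<le> 1" "cmod (g y) = ?r (Suc j)" by blast
      then have "P (Suc j) y" using x True by (auto simp: P_def)
      with \<open>x \<le> y\<close> show ?thesis by blast
    next
      case False
      then show ?thesis using x by (auto simp: P_def)
    qed
  qed
  then obtain t where P: "\<And>j. P j (t j)" and inc: "\<And>j. t j \<le> t (Suc j)" by blast
  have "mono t" using inc by (rule incseq_SucI)
  then have mono: "mono_on {..Suc N} t" by (simp add: mono_on_def monoD)
  have len: "ereal (\<Sum>i<Suc N. dist (g (t i)) (g (t (Suc i)))) \<le> path_length g"
    unfolding path_length_def
    by (rule SUP_upper2[of "(Suc N, t)"]) (use P[of 0] P[of "Suc N"] mono in \<open>auto simp: P_def\<close>)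
  have side: "?r j / 2 < (-1)^j * Re (g (t j))" if j: "j \<in> {1..N}" for j
  proof (rule ccontr)
    assume "\<not> ?thesis"
    then have "g (t j) \<in> labyrinth N" using P[of j] j by (auto simp: labyrinth_def P_def)
    moreover have "g (t j) \<in> path_image g" using P[of j] by (auto simp: P_def path_image_def)
    ultimately show False using g(2) by blast
  qed
  have jump: "1/4 \<le> dist (g (t j)) (g (t (Suc j)))" if j: "j \<in> {1..<N}" for j
  proof -
    have r: "1/8 \<le> ?r i / 2" for i by (simp add: ring_radius_def)
    have "1/8 < (-1)^j * Re (g (t j))" "1/8 < (-1)^(Suc j) * Re (g (t (Suc j)))"
      by (rule le_less_trans[OF r side], use j in simp)+
    then have "1/4 < (-1)^j * (Re (g (t j)) - Re (g (t (Suc j))))" by (simp add: algebra_simps)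
    also have "\<dots> \<le> \<bar>(-1)^j * (Re (g (t j)) - Re (g (t (Suc j))))\<bar>" by simp
    also have "\<dots> = \<bar>Re (g (t j) - g (t (Suc j)))\<bar>" by (simp add: abs_mult)
    also have "\<dots> \<le> dist (g (t j)) (g (t (Suc j)))" unfolding dist_norm by (rule abs_Re_le_cmod)
    finally show ?thesis by simp
  qed
  have "(real N - 1) / 4 = (\<Sum>j\<in>{1..<N}. 1/4)" using False by (simp add: of_nat_diff)
  also have "\<dots> \<le> (\<Sum>j\<in>{1..<N}. dist (g (t j)) (g (t (Suc j))))" by (rule sum_mono) (use jump in auto)
  also have "\<dots> \<le> (\<Sum>j<Suc N. dist (g (t j)) (g (t (Suc j))))" by (rule sum_mono2) auto
  finally show ?thesis using len by (meson ereal_less_eq(3) order_trans)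
qed

section \<open>The lower bound\<close>

lemma escape_length_lower:
  assumes N: "2 \<le> N" and n: "2^(2048 * N * (2 * N + 2) + 5) \<le> n"
  shows "ereal ((real N - 1) / 4) \<le> escape_length n"
proof -
  define k where "k = 2048 * N * (2 * N + 2)"
  define M :: nat where "M = 2^(k+2)"
  obtain a where a: "(pole_step (labyrinth N \<union> sphere 0 20) ^^ k) 0 a" "cmod a = 16"
    using pole_steps_out_of_labyrinth[OF N] unfolding k_def by blast
  have W0: "0 \<notin> labyrinth N" using labyrinth_annulus(2)[of 0 N] by auto
  have W1: "labyrinth N \<subseteq> cball 0 (1/2)" using labyrinth_annulus(1) by (auto simp: dist_norm)
  then have W2: "labyrinth N \<subseteq> cball 0 1" by (rule order_trans) auto
  obtain G where G: "degree G \<le> 2^(k+3) + 1" "poly G 0 = 0"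
      "\<And>z. z \<in> labyrinth N \<Longrightarrow> cmod (poly G z - 1) \<le> 1/2"
      "\<And>z. z \<in> cball 0 1 \<Longrightarrow> cmod (poly G z) \<le> 2 * 13^M"
    using pole_push_to_infinity[OF a(1) W0 W2] a(2) unfolding M_def by auto
  have D: "2^(k+3) + 1 = 2 * M + 1" by (simp add: M_def power_add)
  have M1: "1 \<le> M" by (simp add: M_def)
  \<comment> \<open>This leaves \<open>n - (2 * M + 1) \<ge> 4 * M + 5\<close>, and
    \<open>2^(4 * M + 5) = 32 * 16^M\<close> is at least \<open>16 * (2 * 13^M)\<close>, as
    \<open>monic_disc_poly_large_on\<close> requires.\<close>
  have n': "8 * M \<le> n" using n by (simp add: M_def k_def power_add)
  have "(1/2::real)^(n - (2 * M + 1)) \<le> (1/2)^(4 * M + 5)" if "6 * M + 6 \<le> n"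
    by (rule power_decreasing) (use that in auto)
  moreover have "3 \<le> M" using one_le_power[of "2::nat" k] unfolding M_def power_add power2_eq_square by linarith
  ultimately have "(1/2::real)^(n - (2 * M + 1)) \<le> (1/2)^(4 * M + 5)" using n' by simp
  also have "\<dots> = 1 / (32 * 16^M)" by (simp add: power_add power_mult power_divide)
  also have "\<dots> \<le> 1 / (32 * 13^M)" by (intro divide_left_mono mult_left_mono power_mono) auto
  finally have small: "(1/2::real)^(n - (2 * M + 1)) \<le> 1 / (16 * (2 * 13^M))" by simp
  have big: "(1::real) \<le> 2 * 13^M" using one_le_power[of "13::real" M] by linarith
  have Dn: "2 * M + 1 < n" using n' M1 by linarith
  obtain f where f: "f \<in> monic_disc_polys n" "\<And>z. z \<in> labyrinth N \<Longrightarrow> 1 < cmod (poly f z)"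
    using monic_disc_poly_large_on[OF G(1)[unfolded D] G(2-4) W1 W0 big Dn small] by blast
  have "ereal ((real N - 1) / 4) \<le> (INF g\<in>escape_paths f. path_length g)"
  proof (rule INF_greatest)
    fix g assume g: "g \<in> escape_paths f"
    have "path_image g \<inter> labyrinth N = {}"
      using g f(2) by (fastforce simp: escape_paths_def lemniscate_disc_def)
    then show "ereal ((real N - 1) / 4) \<le> path_length g"
      using g by (intro path_length_avoiding_labyrinth)
        (auto simp: escape_paths_def rectifiable_path_def pathstart_def pathfinish_def)
  qed
  also have "\<dots> \<le> escape_length n" unfolding escape_length_def by (rule SUP_upper[OF f(1)])
  finally show ?thesis .
qed

lemma escape_length_lower_sqrt_ln:
  assumes n: "320 \<le> sqrt (ln (real n))"
  shows "ereal (1/640 * sqrt (ln (real n))) \<le> escape_length n"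
proof -
  define s where "s = sqrt (ln (real n))"
  \<comment> \<open>The exponent \<open>4096 * N^2 + 4096 * N + 5\<close> is at most
    \<open>(80 * N)^2\<close> for \<open>N \<ge> 2\<close>, hence at most \<open>s^2 = ln n\<close>
    for this \<open>N\<close>.\<close>
  define N where "N = nat \<lfloor>s / 80\<rfloor>"
  have s: "320 \<le> s" using n by (simp add: s_def)
  have "ln (real n) > 0" using n real_sqrt_le_0_iff[of "ln (real n)"] by (smt (verit))
  then have s2: "s^2 = ln (real n)" and n0: "0 < real n" by (auto simp: s_def intro: gr0I)
  have N1: "real N \<le> s / 80" "s / 80 < real N + 1" unfolding N_def using s by linarith+
  then have N2: "2 \<le> N" using s by linarith
  define k where "k = 2048 * N * (2 * N + 2)"
  have "real k = 4096 * (real N)^2 + 4096 * real N" by (simp add: k_def power2_eq_square algebra_simps)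
  moreover have "2 * real N \<le> real N * real N" using N2 by (intro mult_right_mono) auto
  moreover have "5 \<le> 4 * real N" using N2 by linarith
  ultimately have "real k + 5 \<le> 6400 * (real N)^2" unfolding power2_eq_square by linarith
  also have "\<dots> = (80 * real N)^2" by (simp add: power2_eq_square)
  also have "\<dots> \<le> s^2" using N1(1) by (intro power_mono) auto
  finally have k: "real (k + 5) \<le> ln (real n)" using s2 by simp
  have "real (2^(k + 5)) = exp (real (k + 5) * ln 2)" unfolding exp_of_nat_mult by simp
  also have "\<dots> \<le> exp (real (k + 5) * 1)" using ln_2_less_1 by (intro exp_mono mult_left_mono) auto
  also have "\<dots> \<le> exp (ln (real n))" using k by simp
  also have "\<dots> = real n" using n0 by simp
  finally have "2^(k + 5) \<le> n" by (simp only: of_nat_le_iff)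
  then have "ereal ((real N - 1) / 4) \<le> escape_length n"
    using escape_length_lower[OF N2] by (simp add: k_def)
  \<comment> \<open>\<open>(N - 1) / 4\<close> exceeds
    \<open>(s / 80 - 2) / 4 = s / 320 - 1/2\<close>, and \<open>1/2 \<le> s / 640\<close> because
    \<open>s \<ge> 320\<close>.\<close>
  moreover have "1/640 * s \<le> (real N - 1) / 4" using N1 s by simp
  ultimately show ?thesis unfolding s_def by (meson ereal_less_eq(3) order_trans)
qed

theorem theorem1p2:
  shows "(\<exists>c::real. c > 0 \<and>
           (\<forall>\<^sub>F n in sequentially.
              ereal (c * sqrt (ln (real n))) \<le> escape_length n \<and>
              escape_length n \<le> ereal (pi * real n)))
         \<and> escape_length \<longlonglongrightarrow> \<infinity>"
proof
  have sqrt_ln: "filterlim (\<lambda>n. sqrt (ln (real n))) at_top sequentially"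
    by (intro filterlim_compose[OF sqrt_at_top] filterlim_compose[OF ln_at_top] filterlim_real_sequentially)
  then have "\<forall>\<^sub>F n in sequentially. 320 \<le> sqrt (ln (real n))" by (simp add: filterlim_at_top)
  then have lower: "\<forall>\<^sub>F n in sequentially. ereal (1/640 * sqrt (ln (real n))) \<le> escape_length n"
    by (rule eventually_mono) (rule escape_length_lower_sqrt_ln)
  moreover have "\<forall>\<^sub>F n in sequentially. escape_length n \<le> ereal (pi * real n)"
    using eventually_ge_at_top[of "1::nat"] by (rule eventually_mono) (rule escape_length_upper)
  ultimately show "\<exists>c::real. c > 0 \<and> (\<forall>\<^sub>F n in sequentially.
      ereal (c * sqrt (ln (real n))) \<le> escape_length n \<and> escape_length n \<le> ereal (pi * real n))"
    by (intro exI[of _ "1/640"] conjI eventually_conj) auto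
  have "filterlim (\<lambda>n. 1/640 * sqrt (ln (real n))) at_top sequentially"
    by (rule filterlim_tendsto_pos_mult_at_top[OF tendsto_const _ sqrt_ln]) simp
  then have "(\<lambda>n. ereal (1/640 * sqrt (ln (real n)))) \<longlonglongrightarrow> \<infinity>"
    by (simp only: tendsto_PInfty_eq_at_top)
  then have "\<forall>\<^sub>F n in sequentially. ereal r < ereal (1/640 * sqrt (ln (real n)))" for r
    by (simp only: tendsto_PInfty)
  then have "\<forall>\<^sub>F n in sequentially. ereal r < escape_length n" for r
    using lower by (rule eventually_elim2[of _ _ "\<lambda>n. ereal (1/640 * sqrt (ln (real n))) \<le> escape_length n"]) (rule order.strict_trans2)
  then show "escape_length \<longlonglongrightarrow> \<infinity>" unfolding tendsto_PInfty by blast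
qed

end
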